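(* Consider a single time step $[t^{(n)},t^{(n+1)}]$ of the Lagrangian remapping method described in the context. Suppose that $\delta\propto h$. Suppose that the liquid domain approximation has local order of accuracy $r$, i.e. $$E_0^{\mathrm{Rec}} = M_0\left(\check{\Omega}_c^{l}\,\triangle\,\Omega_c^{l}\right)=\mathcal{O}(h^{r})$$ (uniformly in $c\in\mathcal{C}$), and that the time integration method has order of accuracy $q$. Then $$\|\check{\alpha}-\alpha\|_{L^\infty} = \mathcal{O}(h^{r-2})+\mathcal{O}(h^2)+\mathcal{O}(h^2+h^q),$$ where the three terms on the right are the contributions of the reconstruction, of the polygonal representation of the preimage, and of the (approximate) integration of its vertices, respectively. Here $\alpha$ and $\check\alpha$ are the exact and approximate volume fractions at time $t^{(n+1)}$.
   Context: **Mesh and velocity.** $\Omega\subset\mathbb{R}^2$ is the computational domain, partitioned into a finite set $\mathcal{C}$ of polygonal control volumes $c$; $h$ is the maximum diameter of the control volumes. The mesh family is shape-regular and quasi-uniform: the number of edges per control volume is bounded and $M_0(c)\ge C h^2$ with $C>0$ independent of $h$ and $c$. $\mathcal{C}(c)$ is the set of control volumes sharing at least one vertex with $c$ (including $c$). $\mathbf{u}(t,\mathbf{x})$ is a given sufficiently smooth divergence-free velocity field, and $\delta=t^{(n+1)}-t^{(n)}>0$ is the time step, satisfying the CFL restriction $\delta\le h/U$ with $U>0$ a velocity scale bounding $|\mathbf{u}|$. $\mathcal{O}(\cdot)$ is understood as $h\to0$ (hence $\delta\to0$), uniformly in $c$. **Moments and sets.** For $A\subset\mathbb{R}^2$, $M_0(A)=\int_A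 dV$ is the area of $A$. $A\triangle B=(A\cup B)\setminus(A\cap B)$. **Exact evolution.** $\Psi^\delta\mathbf{x}_0=\mathbf{x}(t^{(n+1)})$, where $\frac{d}{dt}\mathbf{x}=\mathbf{u}(t,\mathbf{x}(t))$, $\mathbf{x}(t^{(n)})=\mathbf{x}_0$; $\Psi^\delta$ is invertible with inverse $\Psi^{-\delta}$, and both act on sets pointwise. The liquid domain satisfies $\Omega^{l,(n+1)}=\Psi^\delta\Omega^{l,(n)}$. The exact preimage of $c$ is $P_c=\Psi^{-\delta}c$. The liquid neighbourhood of $c$ at $t^{(n)}$ is $\Omega_c^{l}=\Omega^{l,(n)}\cap\bigcup_{c'\in\mathcal{C}(c)}c'$. Under the CFL restriction the preimages of $c$ (exact and approximate) are taken not to overlap any control volumes other than those in $\mathcal{C}(c)$, i.e. they lie in $\bigcup_{c'\in\mathcal{C}(c)}c'$. The exact liquid volume at $t^{(n+1)}$ is $M_{0,c}^{l}=M_0(c\cap\Omega^{l,(n+1)})=M_0(P_c\cap\Omega_c^{l})$. **Approximation.** $\check{\Omega}_c^{l}\subset\bigcup_{c'\in\mathcal{C}(c)}c'$ is an approximation of $\Omega_c^{l}$. The polygon $P_c^{\mathrm{Rep}}$ is obtained by connecting the corners of $P_c$ (the images under $\Psi^{-\delta}$ of the vertices of $c$) by straight line segments. The approximate preimage $\check{P}_c$ is the polygon obtained from $P_c^{\mathrm{Rep}}$ by replacing each vertex by its numerical approximation: the pathline through the corresponding vertex of $c$ is integrated backwards in time from $t^{(n+1)}$ to $t^{(n)}$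 in one step of a time integration method of order $q$, using a velocity field $\mathbf{u}^{\mathrm{Int}}$ obtained by linear interpolation in space and time of $\mathbf{u}$ from its values on a staggered grid, so that $|\mathbf{u}^{\mathrm{Int}}-\mathbf{u}|_2=\mathcal{O}((h+\delta)^2)$. Order $q$ means that the one-step error relative to the exact pathline of $\mathbf{u}^{\mathrm{Int}}$ is $\mathcal{O}(\delta^{q+1})$. The approximate liquid volume at $t^{(n+1)}$ is $\check{M}_{0,c}^{l}=M_0(\check{P}_c\cap\check{\Omega}_c^{l})$. **Volume fractions.** $\alpha_c=M_{0,c}^{l}/M_0(c)$, $\check{\alpha}_c=\check{M}_{0,c}^{l}/M_0(c)$, and $\|\alpha\|_{L^\infty}=\max_{c\in\mathcal{C}}|\alpha_c|$. *)

theory Defs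
  imports
    "HOL-Complex_Analysis.Complex_Analysis"
    "HOL-Library.Landau_Symbols"
    "HOL-Library.Function_Algebras"
    "HOL-Library.Set_Algebras"
begin

text \<open>
  The plane is the type \<^typ>\<open>complex\<close>, used only as a two-dimensional Euclidean space;
  this gives access to the library's winding numbers.
\<close>

abbreviation M0 :: "complex set \<Rightarrow> real"
  where "M0 \<equiv> measure lebesgue"


subsection \<open>Polygons\<close>

text \<open>A polygon is given by the cyclic list of its vertices.\<close>

fun polyline :: "complex list \<Rightarrow> real \<Rightarrow> complex"
  where
    "polyline [] = linepath 0 0"
  | "polyline [a] = linepath a a"
  | "polyline [a, b] = linepath a b"
  | "polyline (a # b # c # vs) = linepath a b +++ polyline (b # c # vs)"

definition boundary_path :: "complex list \<Rightarrow> real \<Rightarrow> complex"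
  where "boundary_path vs = polyline (vs @ [hd vs])"

text \<open>
  The closed region bounded by a polygon. If the boundary path is simple, this is the boundary
  together with its inside in the sense of the Jordan curve theorem. The polygons obtained by moving
  the vertices of a control volume need not be simple; the nonzero winding number rule gives their
  region a meaning in every case.
\<close>

definition polygon :: "complex list \<Rightarrow> complex set"
  where "polygon vs =
    path_image (boundary_path vs) \<union>
    {z. z \<notin> path_image (boundary_path vs) \<and> winding_number (boundary_path vs) z \<noteq> 0}"


subsection \<open>Meshes\<close>

text \<open>A mesh is a set of control volumes, each given by its list of vertices.\<close>

definition is_mesh :: "complex set \<Rightarrow> complex list set \<Rightarrow> bool"
  where "is_mesh \<Omega> C \<longleftrightarrow>
    finite C \<and> C \<noteq> {} \<and>
    (\<forall>c\<in>C. simple_path (boundary_path c)) \<and>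
    (\<Union>c\<in>C. polygon c) = \<Omega> \<and>
    (\<forall>c\<in>C. \<forall>c'\<in>C. c \<noteq> c' \<longrightarrow> interior (polygon c) \<inter> interior (polygon c') = {})"

definition mesh_size :: "complex list set \<Rightarrow> real"
  where "mesh_size C = Max ((\<lambda>c. diameter (polygon c)) ` C)"

definition neighbours :: "complex list set \<Rightarrow> complex list \<Rightarrow> complex list set"
  where "neighbours C c = {c'\<in>C. set c \<inter> set c' \<noteq> {}}"

definition neighbourhood :: "complex list set \<Rightarrow> complex list \<Rightarrow> complex set"
  where "neighbourhood C c = (\<Union>c'\<in>neighbours C c. polygon c')"

definition linf_norm :: "complex list set \<Rightarrow> (complex list \<Rightarrow> real) \<Rightarrow> real"
  where "linf_norm C f = Max ((\<lambda>c. \<bar>f c\<bar>) ` C)"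


subsection \<open>Velocity fields and pathlines\<close>

type_synonym velocity = "real \<Rightarrow> complex \<Rightarrow> complex"

definition divergence :: "(complex \<Rightarrow> complex) \<Rightarrow> complex \<Rightarrow> real"
  where "divergence v x = (\<Sum>b\<in>Basis. frechet_derivative v (at x) b \<bullet> b)"

text \<open>
  ``Sufficiently smooth'' means: twice differentiable in space, with the field and its first two
  spatial derivatives jointly continuous in time and space. No differentiability in time is needed.
\<close>

definition smooth_velocity :: "real set \<Rightarrow> complex set \<Rightarrow> velocity \<Rightarrow> bool"
  where "smooth_velocity J D u \<longleftrightarrow>
    (\<exists>(u' :: real \<Rightarrow> complex \<Rightarrow> complex \<Rightarrow>\<^sub>L complex)
      (u'' :: real \<Rightarrow> complex \<Rightarrow> complex \<Rightarrow>\<^sub>L complex \<Rightarrow>\<^sub>L complex).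
      continuous_on (J \<times> D) (\<lambda>(t, x). u t x) \<and>
      continuous_on (J \<times> D) (\<lambda>(t, x). u' t x) \<and>
      continuous_on (J \<times> D) (\<lambda>(t, x). u'' t x) \<and>
      (\<forall>t\<in>J. \<forall>x\<in>D. (u t has_derivative blinfun_apply (u' t x)) (at x)) \<and>
      (\<forall>t\<in>J. \<forall>x\<in>D. (u' t has_derivative blinfun_apply (u'' t x)) (at x)))"

definition pathline :: "velocity \<Rightarrow> complex set \<Rightarrow> real set \<Rightarrow> (real \<Rightarrow> complex) \<Rightarrow> bool"
  where "pathline u D J y \<longleftrightarrow>
    (\<forall>t\<in>J. y t \<in> D \<and> (y has_vector_derivative u t (y t)) (at t within J))"

text \<open>
  \<open>\<Psi> s t x\<close> is the position at time \<open>t\<close> of the particle that is at \<open>x\<close> at time \<open>s\<close>. Thus the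
  evolution over a time step from \<open>t\<close> to \<open>t + \<delta>\<close> is \<open>\<Psi> t (t + \<delta>)\<close>, with inverse \<open>\<Psi> (t + \<delta>) t\<close>.
\<close>

definition is_flow ::
  "velocity \<Rightarrow> complex set \<Rightarrow> real set \<Rightarrow> complex set \<Rightarrow> (real \<Rightarrow> real \<Rightarrow> complex \<Rightarrow> complex) \<Rightarrow> bool"
  where "is_flow u D J \<Omega> \<Psi> \<longleftrightarrow>
    (\<forall>s\<in>J. \<forall>x\<in>\<Omega>. \<Psi> s s x = x \<and> pathline u D J (\<lambda>t. \<Psi> s t x))"

text \<open>
  A one-step time integration method: \<open>\<Phi> w t \<tau> x\<close> approximates the position at time \<open>t + \<tau>\<close> of the
  particle moving with velocity \<open>w\<close> that is at \<open>x\<close> at time \<open>t\<close>. The step \<open>\<tau>\<close> may be negative.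
\<close>

type_synonym integrator = "velocity \<Rightarrow> real \<Rightarrow> real \<Rightarrow> complex \<Rightarrow> complex"


subsection \<open>Preimages and volume fractions\<close>

definition preimage ::
  "(real \<Rightarrow> real \<Rightarrow> complex \<Rightarrow> complex) \<Rightarrow> real \<Rightarrow> real \<Rightarrow> complex list \<Rightarrow> complex set"
  where "preimage \<Psi> t \<delta> c = \<Psi> (t + \<delta>) t ` polygon c"

definition rep_preimage ::
  "(real \<Rightarrow> real \<Rightarrow> complex \<Rightarrow> complex) \<Rightarrow> real \<Rightarrow> real \<Rightarrow> complex list \<Rightarrow> complex set"
  where "rep_preimage \<Psi> t \<delta> c = polygon (map (\<Psi> (t + \<delta>) t) c)"

definition approx_preimage ::
  "integrator \<Rightarrow> velocity \<Rightarrow> real \<Rightarrow> real \<Rightarrow> complex list \<Rightarrow> complex set"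
  where "approx_preimage \<Phi> w t \<delta> c = polygon (map (\<Phi> w (t + \<delta>) (- \<delta>)) c)"

definition liquid_neighbourhood ::
  "complex list set \<Rightarrow> complex set \<Rightarrow> complex list \<Rightarrow> complex set"
  where "liquid_neighbourhood C L c = L \<inter> neighbourhood C c"

text \<open>Here \<open>L\<close> is the liquid domain at the beginning \<open>t\<close> of the time step.\<close>

definition exact_fraction ::
  "(real \<Rightarrow> real \<Rightarrow> complex \<Rightarrow> complex) \<Rightarrow> real \<Rightarrow> real \<Rightarrow> complex set \<Rightarrow> complex list \<Rightarrow> real"
  where "exact_fraction \<Psi> t \<delta> L c = M0 (polygon c \<inter> \<Psi> t (t + \<delta>) ` L) / M0 (polygon c)"

text \<open>Here \<open>R c\<close> is the approximation of the liquid neighbourhood of \<open>c\<close>.\<close>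

definition approx_fraction ::
  "integrator \<Rightarrow> velocity \<Rightarrow> real \<Rightarrow> real \<Rightarrow> (complex list \<Rightarrow> complex set) \<Rightarrow> complex list \<Rightarrow> real"
  where "approx_fraction \<Phi> w t \<delta> R c = M0 (approx_preimage \<Phi> w t \<delta> c \<inter> R c) / M0 (polygon c)"

definition rec_error ::
  "complex list set \<Rightarrow> complex set \<Rightarrow> (complex list \<Rightarrow> complex set) \<Rightarrow> complex list \<Rightarrow> real"
  where "rec_error C L R c = M0 (sym_diff (R c) (liquid_neighbourhood C L c))"

definition rep_error ::
  "(real \<Rightarrow> real \<Rightarrow> complex \<Rightarrow> complex) \<Rightarrow> real \<Rightarrow> real \<Rightarrow> complex list \<Rightarrow> real"
  where "rep_error \<Psi> t \<delta> c = M0 (sym_diff (rep_preimage \<Psi> t \<delta> c) (preimage \<Psi> t \<delta> c))"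

definition int_error ::
  "(real \<Rightarrow> real \<Rightarrow> complex \<Rightarrow> complex) \<Rightarrow> integrator \<Rightarrow> velocity \<Rightarrow> real \<Rightarrow> real \<Rightarrow> complex list \<Rightarrow> real"
  where "int_error \<Psi> \<Phi> w t \<delta> c =
    M0 (sym_diff (approx_preimage \<Phi> w t \<delta> c) (rep_preimage \<Psi> t \<delta> c))"

end

theory Submission
  imports Defs
begin

text \<open>
  Everything happens within one short time step, on a fixed compact domain, so no long-time theory
  of the flow is needed. A maximum argument (\<open>short_time_stability\<close>) replaces Gronwall's
  inequality throughout: if the length of the time interval times the Lipschitz constant is at
  most one half, the difference of two curves is controlled by its value at one time plus the
  defect.

  The key estimate is \<open>pathlines_affine_combination\<close>: by Taylor's formula, an affine combination
  of pathlines satisfies the equation of motion up to a defect quadratic in their mutual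
  distances, so the flow over time \<open>\<delta>\<close> maps affine combinations, with bounded weights, of points
  at mutual distance \<open>l\<close> to affine combinations up to an error of order \<open>\<delta> l\<^sup>2\<close>. This has three
  consequences.

  \<^item> The image of an edge of a control volume differs from its chord by \<open>O(\<delta> h\<^sup>2) = O(h\<^sup>3)\<close>.

  \<^item> The flow is differentiable at interior points of the domain
    (\<open>differentiable_of_almost_linear\<close>), without differentiating the equation with respect to the
    initial value.

  \<^item> Its Jacobian determinant is one: the cross product of the images of two short orthogonal
    vectors has a time derivative of third order in their length, because the velocity is
    divergence-free (\<open>flow_area_element\<close>). The change of variables formula then shows that the
    flow preserves area, so that the exact liquid volume in \<open>c\<close> is the area of the liquid in its
    preimage (\<open>flow_preserves_liquid_volume\<close>).

  The sets enclosed by two closed curves that are uniformly \<open>\<eta>\<close>-close differ only within distance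
  \<open>\<eta>\<close> of the first curve, because winding numbers are invariant under the linear homotopy. To
  apply this to the exact preimage, \<open>image_enclosed_region\<close> identifies the image of the region
  enclosed by a simple closed curve with the region enclosed by the image curve, using the Jordan
  curve theorem and invariance of domain. The \<open>\<eta>\<close>-neighbourhood of a polygonal line with boundedly
  many edges of length at most \<open>2 h\<close> has area \<open>O(h \<eta> + \<eta>\<^sup>2)\<close>. For the polygonal representation \<open>\<eta>
  = O(h\<^sup>3)\<close>, and for the integration of the vertices \<open>\<eta> = O(h\<^sup>3 + h\<^bsup>q + 1\<^esup>)\<close>; dividing by \<open>M0
  (polygon c) \<ge> C0 * h\<^sup>2\<close> gives the last two terms of the estimate. The splitting of the error is
  an inclusion between symmetric differences (\<open>measure_Int_diff_le\<close>).
\<close>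

section \<open>Differential equations over a short time\<close>

text \<open>
  The interval is so short that the integral of \<open>B * norm (f t)\<close> is at most half the maximum of
  \<open>norm (f t)\<close> and can be absorbed. The times \<open>s\<close> and \<open>t\<close> may come in either order.
\<close>

lemma short_time_stability:
  fixes f f' :: "real \<Rightarrow> complex"
  assumes st: "s \<in> {t0..t1}" "t \<in> {t0..t1}"
    and der: "\<And>t. t \<in> {t0..t1} \<Longrightarrow> (f has_vector_derivative f' t) (at t within {t0..t1})"
    and bnd: "\<And>t. t \<in> {t0..t1} \<Longrightarrow> norm (f' t) \<le> B * norm (f t) + e"
    and B: "B \<ge> 0" "(t1 - t0) * B \<le> 1/2" and e: "e \<ge> 0"
  shows "norm (f t) \<le> 2 * norm (f s) + 2 * (t1 - t0) * e"
proof -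
  have cont: "continuous_on {t0..t1} f"
    using der by (meson continuous_on_eq_continuous_within has_vector_derivative_continuous)
  obtain m where m: "m \<in> {t0..t1}" "\<And>t. t \<in> {t0..t1} \<Longrightarrow> norm (f t) \<le> norm (f m)"
    using continuous_attains_sup[of "{t0..t1}" "\<lambda>t. norm (f t)"] st cont
    by (force intro: continuous_intros)
  let ?M = "norm (f m)"
  have "norm (f m - f s) \<le> (B * ?M + e) * norm (m - s)"
  proof (rule differentiable_bound[of "{t0..t1}" f "\<lambda>t h. h *\<^sub>R f' t"])
    fix t assume t: "t \<in> {t0..t1}"
    show "(f has_derivative (\<lambda>h. h *\<^sub>R f' t)) (at t within {t0..t1})"
      using der[OF t] by (simp add: has_vector_derivative_def)
    have "norm (f' t) \<le> B * ?M + e"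
      using bnd[OF t] m(2)[OF t] B(1) by (smt (verit) mult_left_mono)
    then show "onorm (\<lambda>h. h *\<^sub>R f' t) \<le> B * ?M + e"
      by (intro onorm_le) (simp add: mult.commute mult_left_mono)
  qed (use m st in auto)
  also have "\<dots> \<le> (B * ?M + e) * (t1 - t0)"
    using m(1) st(1) B(1) e by (intro mult_left_mono) auto
  also have "\<dots> = ((t1 - t0) * B) * ?M + (t1 - t0) * e" by (simp add: algebra_simps)
  also have "\<dots> \<le> ?M / 2 + (t1 - t0) * e"
    using mult_right_mono[OF B(2), of ?M] by simp
  finally have "?M \<le> norm (f s) + (?M / 2 + (t1 - t0) * e)"
    using norm_triangle_sub[of "f m" "f s"] by linarith
  then show ?thesis using m(2)[OF st(2)] by linarith
qed

lemma displacement_bound: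
  fixes f f' :: "real \<Rightarrow> complex"
  assumes st: "s \<in> {t0..t1}" "t \<in> {t0..t1}"
    and der: "\<And>t. t \<in> {t0..t1} \<Longrightarrow> (f has_vector_derivative f' t) (at t within {t0..t1})"
    and bnd: "\<And>t. t \<in> {t0..t1} \<Longrightarrow> norm (f' t) \<le> V"
  shows "norm (f t - f s) \<le> (t1 - t0) * V"
proof -
  have V: "V \<ge> 0" using bnd[OF st(1)] norm_ge_zero order_trans by blast
  have "norm (f t - f s) \<le> V * norm (t - s)"
  proof (rule differentiable_bound[of "{t0..t1}" f "\<lambda>t h. h *\<^sub>R f' t"])
    fix t assume t: "t \<in> {t0..t1}"
    show "(f has_derivative (\<lambda>h. h *\<^sub>R f' t)) (at t within {t0..t1})"
      using der[OF t] by (simp add: has_vector_derivative_def)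
    show "onorm (\<lambda>h. h *\<^sub>R f' t) \<le> V"
      using bnd[OF t] by (intro onorm_le) (auto simp: mult.commute[of V] intro!: mult_left_mono)
  qed (use st in auto)
  also have "\<dots> \<le> V * (t1 - t0)" using st V by (intro mult_left_mono) auto
  finally show ?thesis by (simp add: mult.commute)
qed

text \<open>
  The constants are uniform over balls of one radius around all points of the compact set \<open>\<Omega>\<close>. The
  balls matter because \<open>D\<close> need not be convex, while the mean value inequality needs convexity.
\<close>

lemma smooth_velocity_local_bounds:
  assumes sm: "smooth_velocity {0..T} D u" and D: "open D" "\<Omega> \<subseteq> D" and \<Omega>: "compact \<Omega>"
  obtains \<rho> B1 B2 u' where "\<rho> > 0" "B1 \<ge> 0" "B2 \<ge> 0"
    "\<And>t x. t \<in> {0..T} \<Longrightarrow> x \<in> D \<Longrightarrow> (u t has_derivative blinfun_apply (u' t x)) (at x)"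
    "\<And>a t x y. \<lbrakk>a \<in> \<Omega>; t \<in> {0..T}; x \<in> cball a \<rho>; y \<in> cball a \<rho>\<rbrakk>
        \<Longrightarrow> norm (u t x - u t y) \<le> B1 * norm (x - y)"
    "\<And>a t x y. \<lbrakk>a \<in> \<Omega>; t \<in> {0..T}; x \<in> cball a \<rho>; y \<in> cball a \<rho>\<rbrakk>
        \<Longrightarrow> norm (u t x - u t y - blinfun_apply (u' t y) (x - y)) \<le> B2 * (norm (x - y))\<^sup>2"
proof -
  obtain u' :: "real \<Rightarrow> complex \<Rightarrow> complex \<Rightarrow>\<^sub>L complex"
    and u'' :: "real \<Rightarrow> complex \<Rightarrow> complex \<Rightarrow>\<^sub>L complex \<Rightarrow>\<^sub>L complex" where
    c1: "continuous_on ({0..T} \<times> D) (\<lambda>(t, x). u' t x)" and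
    c2: "continuous_on ({0..T} \<times> D) (\<lambda>(t, x). u'' t x)" and
    d1: "\<And>t x. t\<in>{0..T} \<Longrightarrow> x\<in>D \<Longrightarrow> (u t has_derivative blinfun_apply (u' t x)) (at x)" and
    d2: "\<And>t x. t\<in>{0..T} \<Longrightarrow> x\<in>D \<Longrightarrow> (u' t has_derivative blinfun_apply (u'' t x)) (at x)"
    using sm unfolding smooth_velocity_def by blast
  obtain \<rho> where \<rho>: "\<rho> > 0" "(\<Union>x\<in>\<Omega>. cball x \<rho>) \<subseteq> D"
    using compact_subset_open_imp_cball_epsilon_subset[OF \<Omega> D] by blast
  let ?K = "(\<Union>x\<in>\<Omega>. cball x \<rho>)"
  have K: "compact ({0..T} \<times> ?K)" using compact_minkowski_sum_cball[OF \<Omega>]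
      by (auto intro: compact_Times)
  have sub: "{0..T} \<times> ?K \<subseteq> {0..T} \<times> D" using \<rho> by blast
  have "bounded ((\<lambda>(t, x). u' t x) ` ({0..T} \<times> ?K))"
    by (intro compact_imp_bounded compact_continuous_image continuous_on_subset[OF c1 sub] K)
  then obtain B1 where B1: "B1 > 0" "\<And>t x. t \<in> {0..T} \<Longrightarrow> x \<in> ?K \<Longrightarrow> norm (u' t x) \<le> B1"
    unfolding bounded_pos by fastforce
  have "bounded ((\<lambda>(t, x). u'' t x) ` ({0..T} \<times> ?K))"
    by (intro compact_imp_bounded compact_continuous_image continuous_on_subset[OF c2 sub] K)
  then obtain B2 where B2: "B2 > 0" "\<And>t x. t \<in> {0..T} \<Longrightarrow> x \<in> ?K \<Longrightarrow> norm (u'' t x) \<le> B2"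
    unfolding bounded_pos by fastforce
  have lip: "norm (u t x - u t y) \<le> B1 * norm (x - y)"
    if "a \<in> \<Omega>" "t \<in> {0..T}" "x \<in> cball a \<rho>" "y \<in> cball a \<rho>" for a t x y
  proof (rule differentiable_bound[of "cball a \<rho>" _ "\<lambda>x. blinfun_apply (u' t x)"])
    fix z assume z: "z \<in> cball a \<rho>"
    show "(u t has_derivative blinfun_apply (u' t z)) (at z within cball a \<rho>)"
      using d1 that z \<rho> by (blast intro: has_derivative_at_withinI)
    show "onorm (blinfun_apply (u' t z)) \<le> B1"
      using B1(2)[of t z] that z by (auto simp: norm_blinfun.rep_eq)
  qed (use that in auto)
  have lip': "norm (u' t x - u' t y) \<le> B2 * norm (x - y)"
    if "a \<in> \<Omega>" "t \<in> {0..T}" "x \<in> cball a \<rho>" "y \<in> cball a \<rho>" for a t x y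
  proof (rule differentiable_bound[of "cball a \<rho>" _ "\<lambda>x. blinfun_apply (u'' t x)"])
    fix z assume z: "z \<in> cball a \<rho>"
    show "(u' t has_derivative blinfun_apply (u'' t z)) (at z within cball a \<rho>)"
      using d2 that z \<rho> by (blast intro: has_derivative_at_withinI)
    show "onorm (blinfun_apply (u'' t z)) \<le> B2"
      using B2(2)[of t z] that z by (auto simp: norm_blinfun.rep_eq)
  qed (use that in auto)
  have taylor: "norm (u t x - u t y - blinfun_apply (u' t y) (x - y)) \<le> B2 * (norm (x - y))\<^sup>2"
    if a: "a \<in> \<Omega>" "t \<in> {0..T}" "x \<in> cball a \<rho>" "y \<in> cball a \<rho>" for a t x y
  proof -
    have seg: "closed_segment y x \<subseteq> cball a \<rho>"
      using a by (intro closed_segment_subset) auto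
    have "norm (u t x - u t y - blinfun_apply (u' t y) (x - y))
        \<le> norm (x - y) * (B2 * norm (x - y))"
    proof (rule differentiable_bound_linearization[where S = "closed_segment y x"
          and f' = "\<lambda>z. blinfun_apply (u' t z)" and ?x0.0 = y])
      fix z assume z: "z \<in> closed_segment y x"
      show "(u t has_derivative blinfun_apply (u' t z)) (at z within closed_segment y x)"
        using d1 that z \<rho> seg by (blast intro: has_derivative_at_withinI)
      have "norm (u' t z - u' t y) \<le> B2 * norm (z - y)"
        using lip' a z seg by blast
      also have "\<dots> \<le> B2 * norm (x - y)"
        using segment_bound1[OF z] B2(1) by (intro mult_left_mono) (auto simp: norm_minus_commute)
      finally show "onorm (blinfun_apply (u' t z) - blinfun_apply (u' t y)) \<le> B2 * norm (x - y)"
        by (simp add: norm_blinfun.rep_eq minus_blinfun.rep_eq fun_diff_def)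
    qed (auto simp: closed_segment_def algebra_simps intro!: exI)
    then show ?thesis by (simp add: power2_eq_square mult_ac)
  qed
  show ?thesis
    by (rule that[OF \<rho>(1) _ _ d1 lip taylor]) (use B1 B2 \<rho> in auto)
qed

section \<open>Almost linear maps are differentiable\<close>

text \<open>
  Homogeneity up to a second-order error makes the difference quotients along a fixed direction a
  Cauchy family; additivity up to a second-order error extends the two partial derivatives to a
  derivative. The factor \<open>\<alpha>\<close> in the error of homogeneity is what makes the quotients Cauchy.
\<close>

lemma differentiable_of_almost_linear:
  fixes f :: "complex \<Rightarrow> complex"
  assumes \<epsilon>: "\<epsilon> > 0" and K: "K \<ge> 0"
    and hom: "\<And>v \<alpha>. \<lbrakk>norm v < \<epsilon>; 0 < \<alpha>; \<alpha> \<le> 1\<rbrakk>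
      \<Longrightarrow> norm (f (p + \<alpha> *\<^sub>R v) - f p - \<alpha> *\<^sub>R (f (p + v) - f p)) \<le> K * \<alpha> * (norm v)\<^sup>2"
    and add: "\<And>v w. norm v + norm w < \<epsilon>
      \<Longrightarrow> norm (f (p + v + w) - f (p + v) - f (p + w) + f p) \<le> K * (norm v + norm w)\<^sup>2"
  obtains m1 m2 where "(f has_derivative (\<lambda>v. Re v *\<^sub>R m1 + Im v *\<^sub>R m2)) (at p)"
proof -
  define Q where "Q v = f (p + v) - f p" for v
  have hom': "norm (Q (\<alpha> *\<^sub>R v) - \<alpha> *\<^sub>R Q v) \<le> K * \<alpha> * (norm v)\<^sup>2"
    if "norm v < \<epsilon>" "0 < \<alpha>" "\<alpha> \<le> 1" for v \<alpha>
    using hom[OF that] by (simp add: Q_def)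
  have add': "norm (Q (v + w) - Q v - Q w) \<le> K * (norm v + norm w)\<^sup>2"
    if "norm v + norm w < \<epsilon>" for v w
    using add[OF that] by (simp add: Q_def algebra_simps)
  have Q0: "Q 0 = 0" by (simp add: Q_def)
  have direction: "\<exists>m. \<forall>\<tau>. \<bar>\<tau>\<bar> < \<epsilon> / 2 \<longrightarrow> norm (Q (\<tau> *\<^sub>R e) - \<tau> *\<^sub>R m) \<le> 5 * K * \<tau>\<^sup>2"
    if e: "norm e = 1" for e
  proof -
    define g where "g l = Q (l *\<^sub>R e) /\<^sub>R l" for l
    have g: "norm (g l' - g l) \<le> K * l" if "0 < l'" "l' \<le> l" "l < \<epsilon>" for l l'
    proof -
      have "norm (Q ((l'/l) *\<^sub>R (l *\<^sub>R e)) - (l'/l) *\<^sub>R Q (l *\<^sub>R e))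
          \<le> K * (l'/l) * (norm (l *\<^sub>R e))\<^sup>2"
        using that e by (intro hom') auto
      then have *: "norm (Q (l' *\<^sub>R e) - (l'/l) *\<^sub>R Q (l *\<^sub>R e)) \<le> l' * (K * l)"
        using that e by (simp add: power2_eq_square field_simps)
      have "Q (l' *\<^sub>R e) - (l'/l) *\<^sub>R Q (l *\<^sub>R e) = l' *\<^sub>R (g l' - g l)"
        using that by (simp add: g_def algebra_simps divide_inverse_commute)
      then show ?thesis using * that by simp
    qed
    define s where "s n = \<epsilon> / (real n + 2)" for n :: nat
    have s: "0 < s n" "s n < \<epsilon>" for n using \<epsilon>
        by (auto simp: s_def field_simps intro!: add_pos_nonneg)
    have s0: "s \<longlonglongrightarrow> 0" unfolding s_def by real_asymp
    have mono: "s n \<le> s m" if "m \<le> n" for m n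
      unfolding s_def using that \<epsilon> by (intro divide_left_mono) auto
    have "Cauchy (\<lambda>n. g (s n))"
    proof (rule metric_CauchyI)
      fix r :: real assume r: "r > 0"
      have "(\<lambda>n. K * s n) \<longlonglongrightarrow> K * 0" by (intro tendsto_intros s0)
      then have "eventually (\<lambda>n. K * s n < r / 2) sequentially"
        using r by (intro order_tendstoD) auto
      then obtain n0 where n0: "K * s n0 < r / 2" by (auto simp: eventually_sequentially)
      have "dist (g (s m)) (g (s n)) < r" if "m \<ge> n0" "n \<ge> n0" for m n
      proof -
        have "dist (g (s m)) (g (s n0)) < r / 2" "dist (g (s n)) (g (s n0)) < r / 2"
          using g[OF s(1) mono s(2), of n0 m] g[OF s(1) mono s(2), of n0 n] that n0
          by (auto simp: dist_norm)
        then show ?thesis using dist_triangle_half_l by blast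
      qed
      then show "\<exists>M. \<forall>m\<ge>M. \<forall>n\<ge>M. dist (g (s m)) (g (s n)) < r" by blast
    qed
    then obtain m where m: "(\<lambda>n. g (s n)) \<longlonglongrightarrow> m"
      using Cauchy_convergent convergent_def by blast
    have lim: "norm (m - g l) \<le> K * l" if l: "0 < l" "l < \<epsilon>" for l
    proof (rule tendsto_upperbound)
      show "(\<lambda>n. norm (g (s n) - g l)) \<longlonglongrightarrow> norm (m - g l)" by (intro tendsto_intros m)
      have "eventually (\<lambda>n. s n < l) sequentially" using s0 l by (intro order_tendstoD) auto
      then show "eventually (\<lambda>n. norm (g (s n) - g l) \<le> K * l) sequentially"
        by eventually_elim (use g s l in auto)
    qed auto
    \<comment> \<open>Positive multiples of \<open>e\<close> first; negative ones follow from additivity applied to \<open>l e\<close> and \<open>- l e\<close>.\<close>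
    have pos: "norm (Q (l *\<^sub>R e) - l *\<^sub>R m) \<le> K * l\<^sup>2" if l: "0 < l" "l < \<epsilon>" for l
    proof -
      have "Q (l *\<^sub>R e) - l *\<^sub>R m = - l *\<^sub>R (m - g l)" using l by (simp add: g_def algebra_simps)
      then have "norm (Q (l *\<^sub>R e) - l *\<^sub>R m) = l * norm (m - g l)" using l
          by (simp only: norm_scaleR abs_minus_cancel abs_of_pos)
      also have "\<dots> \<le> l * (K * l)" using lim[OF l] l by (intro mult_left_mono) auto
      finally show ?thesis by (simp add: power2_eq_square mult_ac)
    qed
    have "norm (Q (\<tau> *\<^sub>R e) - \<tau> *\<^sub>R m) \<le> 5 * K * \<tau>\<^sup>2" if \<tau>: "\<bar>\<tau>\<bar> < \<epsilon> / 2" for \<tau>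
    proof -
      have nn: "0 \<le> K * \<tau>\<^sup>2" using K by simp
      consider "\<tau> = 0" | "\<tau> > 0" | "\<tau> < 0" by linarith
      then show ?thesis
      proof cases
        case 1 then show ?thesis by (simp add: Q0)
      next
        case 2
        then show ?thesis using pos[of \<tau>] \<tau> nn by (simp add: mult.assoc)
      next
        case 3
        define l where "l = - \<tau>"
        have l: "0 < l" "2 * l < \<epsilon>" using 3 \<tau> by (auto simp: l_def)
        have "norm (Q (l *\<^sub>R e + (- l) *\<^sub>R e) - Q (l *\<^sub>R e) - Q ((- l) *\<^sub>R e))
            \<le> K * (norm (l *\<^sub>R e) + norm ((- l) *\<^sub>R e))\<^sup>2"
          using l e by (intro add') auto
        then have "norm (Q (l *\<^sub>R e) + Q ((- l) *\<^sub>R e)) \<le> 4 * K * l\<^sup>2"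
          using l e norm_minus_cancel[of "Q (l *\<^sub>R e) + Q ((- l) *\<^sub>R e)"]
          by (simp add: Q0 power2_eq_square algebra_simps)
        moreover have "norm (Q (l *\<^sub>R e) - l *\<^sub>R m) \<le> K * l\<^sup>2" using pos[of l] l by simp
        moreover have "Q ((- l) *\<^sub>R e) - (- l) *\<^sub>R m
            = (Q (l *\<^sub>R e) + Q ((- l) *\<^sub>R e)) - (Q (l *\<^sub>R e) - l *\<^sub>R m)" by simp
        ultimately have "norm (Q ((- l) *\<^sub>R e) - (- l) *\<^sub>R m) \<le> 4 * K * l\<^sup>2 + K * l\<^sup>2"
          using norm_triangle_ineq4 by (smt (verit, best))
        then show ?thesis by (simp add: l_def)
      qed
    qed
    then show ?thesis by blast
  qed
  obtain m1 where m1: "\<And>\<tau>. \<bar>\<tau>\<bar> < \<epsilon> / 2 \<Longrightarrow> norm (Q (\<tau> *\<^sub>R 1) - \<tau> *\<^sub>R m1) \<le> 5 * K * \<tau>\<^sup>2"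
    using direction[of 1] by auto
  obtain m2 where m2: "\<And>\<tau>. \<bar>\<tau>\<bar> < \<epsilon> / 2 \<Longrightarrow> norm (Q (\<tau> *\<^sub>R \<i>) - \<tau> *\<^sub>R m2) \<le> 5 * K * \<tau>\<^sup>2"
    using direction[of \<i>] by auto
  let ?M = "\<lambda>v. Re v *\<^sub>R m1 + Im v *\<^sub>R m2"
  have main: "norm (Q v - ?M v) \<le> 14 * K * (norm v)\<^sup>2" if v: "norm v < \<epsilon> / 4" for v
  proof -
    have R: "\<bar>Re v\<bar> \<le> norm v" and I: "\<bar>Im v\<bar> \<le> norm v"
      by (auto simp: abs_Re_le_cmod abs_Im_le_cmod)
    have eq: "v = Re v *\<^sub>R 1 + Im v *\<^sub>R \<i>" by (simp add: complex_eq_iff)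
    have "norm (Q v - Q (Re v *\<^sub>R 1) - Q (Im v *\<^sub>R \<i>))
        \<le> K * (norm (Re v *\<^sub>R (1::complex)) + norm (Im v *\<^sub>R \<i>))\<^sup>2"
      by (subst (1) eq, rule add') (use R I v in \<open>simp add: norm_mult\<close>)
    also have "\<dots> \<le> K * (2 * norm v)\<^sup>2"
      using R I K by (intro mult_left_mono power_mono) auto
    finally have 1: "norm (Q v - Q (Re v *\<^sub>R 1) - Q (Im v *\<^sub>R \<i>)) \<le> 4 * (K * (norm v)\<^sup>2)"
      by (simp add: power_mult_distrib)
    have "norm (Q (Re v *\<^sub>R 1) - Re v *\<^sub>R m1) \<le> 5 * K * (Re v)\<^sup>2" using R v by (intro m1) auto
    also have "\<dots> \<le> 5 * K * (norm v)\<^sup>2" using K R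
        by (intro mult_left_mono) (auto simp: abs_le_square_iff[symmetric])
    finally have 2: "norm (Q (Re v *\<^sub>R 1) - Re v *\<^sub>R m1) \<le> 5 * (K * (norm v)\<^sup>2)" by simp
    have "norm (Q (Im v *\<^sub>R \<i>) - Im v *\<^sub>R m2) \<le> 5 * K * (Im v)\<^sup>2" using I v by (intro m2) auto
    also have "\<dots> \<le> 5 * K * (norm v)\<^sup>2" using K I
        by (intro mult_left_mono) (auto simp: abs_le_square_iff[symmetric])
    finally have 3: "norm (Q (Im v *\<^sub>R \<i>) - Im v *\<^sub>R m2) \<le> 5 * (K * (norm v)\<^sup>2)" by simp
    have "Q v - ?M v = (Q v - Q (Re v *\<^sub>R 1) - Q (Im v *\<^sub>R \<i>)) + ((Q (Re v *\<^sub>R 1) - Re v *\<^sub>R m1)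
        + (Q (Im v *\<^sub>R \<i>) - Im v *\<^sub>R m2))"
      by simp
    also have "norm \<dots> \<le> 4 * (K * (norm v)\<^sup>2) + (5 * (K * (norm v)\<^sup>2) + 5 * (K * (norm v)\<^sup>2))"
      by (intro norm_triangle_mono 1 2 3)
    finally show ?thesis by simp
  qed
  have "(f has_derivative ?M) (at p)"
  proof (rule has_derivativeI_sandwich[where H = "\<lambda>y. 14 * K * norm (y - p)" and e = "\<epsilon> / 4"])
    show "bounded_linear ?M"
      by (intro bounded_linear_add bounded_linear_scaleR_const bounded_linear_Re bounded_linear_Im)
    fix y assume "y \<noteq> p" "dist y p < \<epsilon> / 4"
    then show "norm (f y - f p - ?M (y - p)) / norm (y - p) \<le> 14 * K * norm (y - p)"
      using main[of "y - p"] by (simp add: Q_def dist_norm power2_eq_square divide_le_eq mult_ac)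
  next
    have "((\<lambda>y. 14 * K * norm (y - p)) \<longlongrightarrow> 14 * K * norm (p - p)) (at p)" by (intro tendsto_intros)
    then show "((\<lambda>y. 14 * K * norm (y - p)) \<longlongrightarrow> 0) (at p)" by simp
  qed (use \<epsilon> in auto)
  then show ?thesis by (rule that)
qed

section \<open>The flow over a short time step\<close>

text \<open>
  A flow on \<open>\<Omega>\<close> over a time interval \<open>{t0..t1}\<close> that is short compared with the Lipschitz constant
  of the velocity and with the radius \<open>\<rho>\<close> of the balls on which the bounds \<open>B1\<close>, \<open>B2\<close> hold. The
  bound \<open>\<rho> / 6\<close> on the displacement keeps pathlines that start within \<open>\<rho> / 6\<close> of a point \<open>a\<close>
  within \<open>\<rho> / 3\<close> of it, and hence affine combinations of three of them, with weights of total
  absolute value at most three, within \<open>\<rho>\<close>. The field \<open>u'\<close> is the spatial derivative of \<open>u\<close>;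
  \<open>trace0\<close> says that \<open>u\<close> is divergence-free.
\<close>

locale short_time_flow =
  fixes u :: velocity and D \<Omega> :: "complex set" and t0 t1 \<rho> B1 B2 U :: real
    and u' :: "real \<Rightarrow> complex \<Rightarrow> complex \<Rightarrow>\<^sub>L complex"
    and \<Psi> :: "real \<Rightarrow> real \<Rightarrow> complex \<Rightarrow> complex"
  assumes t01: "t0 \<le> t1" and \<rho>: "\<rho> > 0" and B: "B1 \<ge> 0" "B2 \<ge> 0"
    and lip: "\<And>a t x y. \<lbrakk>a \<in> \<Omega>; t \<in> {t0..t1}; x \<in> cball a \<rho>; y \<in> cball a \<rho>\<rbrakk>
        \<Longrightarrow> norm (u t x - u t y) \<le> B1 * norm (x - y)"
    and taylor: "\<And>a t x y. \<lbrakk>a \<in> \<Omega>; t \<in> {t0..t1}; x \<in> cball a \<rho>; y \<in> cball a \<rho>\<rbrakk>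
        \<Longrightarrow> norm (u t x - u t y - blinfun_apply (u' t y) (x - y)) \<le> B2 * (norm (x - y))\<^sup>2"
    and trace0: "\<And>t x. \<lbrakk>t \<in> {t0..t1}; x \<in> D\<rbrakk>
        \<Longrightarrow> Re (blinfun_apply (u' t x) 1) + Im (blinfun_apply (u' t x) \<i>) = 0"
    and speed: "\<And>t x. \<lbrakk>t \<in> {t0..t1}; x \<in> D\<rbrakk> \<Longrightarrow> norm (u t x) \<le> U"
    and flow: "is_flow u D {t0..t1} \<Omega> \<Psi>"
    and short: "(t1 - t0) * B1 \<le> 1/2" "(t1 - t0) * U \<le> \<rho> / 6"
begin

lemma pathline_near:
  assumes "pathline u D {t0..t1} x" "s \<in> {t0..t1}" "t \<in> {t0..t1}" "norm (x s - a) \<le> \<rho> / 6"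
  shows "norm (x t - a) \<le> \<rho> / 3"
proof -
  have "norm (x t - x s) \<le> (t1 - t0) * U"
    using assms speed unfolding pathline_def
        by (intro displacement_bound[where f' = "\<lambda>t. u t (x t)"]) auto
  then show ?thesis using short(2) assms(4) norm_triangle_ineq[of "x t - x s" "x s - a"] by simp
qed

lemma pathline_perturbation:
  assumes x: "pathline u D {t0..t1} x" and y: "pathline w D {t0..t1} y"
    and st: "s \<in> {t0..t1}" "t \<in> {t0..t1}"
    and a: "a \<in> \<Omega>" "\<And>t. t \<in> {t0..t1} \<Longrightarrow> x t \<in> cball a \<rho>" "\<And>t. t \<in> {t0..t1} \<Longrightarrow> y t \<in> cball a \<rho>"
    and e: "e \<ge> 0" "\<And>t z. t \<in> {t0..t1} \<Longrightarrow> z \<in> D \<Longrightarrow> norm (w t z - u t z) \<le> e"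
  shows "norm (x t - y t) \<le> 2 * norm (x s - y s) + 2 * (t1 - t0) * e"
proof (rule short_time_stability[where f' = "\<lambda>t. u t (x t) - w t (y t)" and B = B1])
  fix t assume t: "t \<in> {t0..t1}"
  show "((\<lambda>t. x t - y t) has_vector_derivative u t (x t) - w t (y t)) (at t within {t0..t1})"
    using x y t unfolding pathline_def by (intro has_vector_derivative_diff) auto
  have "norm (u t (x t) - u t (y t)) \<le> B1 * norm (x t - y t)" using lip a t by blast
  moreover have "norm (w t (y t) - u t (y t)) \<le> e" using e t y unfolding pathline_def by blast
  ultimately show "norm (u t (x t) - w t (y t)) \<le> B1 * norm (x t - y t) + e"
    using norm_triangle_ineq4[of "u t (x t) - u t (y t)" "w t (y t) - u t (y t)"] by simp
qed (use st B short e in auto)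

lemma pathlines_lipschitz:
  assumes x: "pathline u D {t0..t1} x" and y: "pathline u D {t0..t1} y"
    and st: "s \<in> {t0..t1}" "t \<in> {t0..t1}"
    and a: "a \<in> \<Omega>" "norm (x s - a) \<le> \<rho> / 6" "norm (y s - a) \<le> \<rho> / 6"
  shows "norm (x t - y t) \<le> 2 * norm (x s - y s)"
proof -
  have "norm (x t - y t) \<le> 2 * norm (x s - y s) + 2 * (t1 - t0) * 0"
  proof (rule pathline_perturbation[OF x y st a(1)])
    fix t assume t: "t \<in> {t0..t1}"
    show "x t \<in> cball a \<rho>" "y t \<in> cball a \<rho>"
      using pathline_near[OF x st(1) t a(2)] pathline_near[OF y st(1) t a(3)] \<rho>
      by (auto simp: dist_norm norm_minus_commute)
  qed auto
  then show ?thesis by simp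
qed

lemma pathlines_unique:
  assumes "pathline u D {t0..t1} x" "pathline u D {t0..t1} y"
    and "s \<in> {t0..t1}" "t \<in> {t0..t1}" and "x s = y s" "y s \<in> \<Omega>"
  shows "x t = y t"
  using pathlines_lipschitz[OF assms(1-4,6)] assms(5) \<rho> by simp

text \<open>
  The curve \<open>W\<close> solves the equation of motion up to a defect: in the Taylor expansions of \<open>u\<close> at
  \<open>W t\<close> the linear terms cancel, because \<open>l0 * (x0 - W) + l1 * (x1 - W) + l2 * (x2 - W) = 0\<close>.
\<close>

lemma pathlines_affine_combination:
  assumes x0: "pathline u D {t0..t1} x0" and x1: "pathline u D {t0..t1} x1"
    and x2: "pathline u D {t0..t1} x2" and z: "pathline u D {t0..t1} z"
    and st: "s \<in> {t0..t1}" "t \<in> {t0..t1}"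
    and a: "a \<in> \<Omega>" "norm (x0 s - a) \<le> \<rho> / 6" "norm (x1 s - a) \<le> \<rho> / 6"
      "norm (x2 s - a) \<le> \<rho> / 6" "norm (z s - a) \<le> \<rho> / 6"
    and sum: "l0 + l1 + l2 = (1::real)" "\<bar>l0\<bar> + \<bar>l1\<bar> + \<bar>l2\<bar> \<le> 3"
    and z0: "z s = l0 *\<^sub>R x0 s + l1 *\<^sub>R x1 s + l2 *\<^sub>R x2 s"
    and W: "\<And>t. W t = l0 *\<^sub>R x0 t + l1 *\<^sub>R x1 t + l2 *\<^sub>R x2 t"
    and E: "\<And>t. t \<in> {t0..t1} \<Longrightarrow> \<bar>l0\<bar> * (norm (x0 t - W t))\<^sup>2 + \<bar>l1\<bar> * (norm (x1 t - W t))\<^sup>2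
        + \<bar>l2\<bar> * (norm (x2 t - W t))\<^sup>2 \<le> E" "E \<ge> 0"
  shows "norm (z t - W t) \<le> 2 * (t1 - t0) * (B2 * E)"
proof -
  have "norm (z t - W t) \<le> 2 * norm (z s - W s) + 2 * (t1 - t0) * (B2 * E)"
  proof (rule short_time_stability[where B = B1 and f' = "\<lambda>t. u t (z t) -
      (l0 *\<^sub>R u t (x0 t) + l1 *\<^sub>R u t (x1 t) + l2 *\<^sub>R u t (x2 t))"])
    fix t assume t: "t \<in> {t0..t1}"
    have dx: "(x0 has_vector_derivative u t (x0 t)) (at t within {t0..t1})"
      "(x1 has_vector_derivative u t (x1 t)) (at t within {t0..t1})"
      "(x2 has_vector_derivative u t (x2 t)) (at t within {t0..t1})"
      "(z has_vector_derivative u t (z t)) (at t within {t0..t1})"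
      using x0 x1 x2 z t by (auto simp: pathline_def)
    have Weq: "W = (\<lambda>t. l0 *\<^sub>R x0 t + l1 *\<^sub>R x1 t + l2 *\<^sub>R x2 t)" using W by auto
    show "((\<lambda>t. z t - W t) has_vector_derivative u t (z t) -
      (l0 *\<^sub>R u t (x0 t) + l1 *\<^sub>R u t (x1 t) + l2 *\<^sub>R u t (x2 t))) (at t within {t0..t1})"
      unfolding Weq by (intro has_vector_derivative_diff has_vector_derivative_add
        dx bounded_linear.has_vector_derivative[OF bounded_linear_scaleR_right])
    have scaled: "norm (l *\<^sub>R y) \<le> \<bar>l\<bar> * c" if "norm y \<le> c" for l c and y :: complex
      using that by (simp add: mult_left_mono)
    have n: "norm (x0 t - a) \<le> \<rho> / 3" "norm (x1 t - a) \<le> \<rho> / 3" "norm (x2 t - a) \<le> \<rho> / 3"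
        "norm (z t - a) \<le> \<rho> / 3"
      using pathline_near st t a x0 x1 x2 z by blast+
    have b: "x0 t \<in> cball a \<rho>" "x1 t \<in> cball a \<rho>" "x2 t \<in> cball a \<rho>" "z t \<in> cball a \<rho>"
      using n \<rho> by (auto simp: dist_norm norm_minus_commute)
    have a1: "a = l0 *\<^sub>R a + l1 *\<^sub>R a + l2 *\<^sub>R a" using sum(1) by (simp flip: scaleR_left.add)
    have "W t - a = l0 *\<^sub>R (x0 t - a) + l1 *\<^sub>R (x1 t - a) + l2 *\<^sub>R (x2 t - a)"
      unfolding W by (subst (1) a1) (simp add: algebra_simps)
    also have "norm \<dots> \<le> \<bar>l0\<bar> * (\<rho> / 3) + \<bar>l1\<bar> * (\<rho> / 3) + \<bar>l2\<bar> * (\<rho> / 3)"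
      by (intro norm_triangle_mono scaled n)
    also have "\<dots> = (\<bar>l0\<bar> + \<bar>l1\<bar> + \<bar>l2\<bar>) * (\<rho> / 3)" by (simp add: algebra_simps)
    also have "\<dots> \<le> 3 * (\<rho> / 3)" using sum(2) \<rho> by (intro mult_right_mono) auto
    finally have Wb: "W t \<in> cball a \<rho>" by (simp add: dist_norm norm_minus_commute)
    define r where "r x = u t x - u t (W t) - blinfun_apply (u' t (W t)) (x - W t)" for x
    have r: "norm (r x) \<le> B2 * (norm (x - W t))\<^sup>2" if "x \<in> cball a \<rho>" for x
      unfolding r_def using taylor a(1) t that Wb by blast
    have W1: "l0 *\<^sub>R W t + l1 *\<^sub>R W t + l2 *\<^sub>R W t = W t"
        "l0 *\<^sub>R u t (W t) + l1 *\<^sub>R u t (W t) + l2 *\<^sub>R u t (W t) = u t (W t)"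
      using sum(1) by (simp_all flip: scaleR_left.add)
    have "l0 *\<^sub>R (x0 t - W t) + l1 *\<^sub>R (x1 t - W t) + l2 *\<^sub>R (x2 t - W t)
        = W t - (l0 *\<^sub>R W t + l1 *\<^sub>R W t + l2 *\<^sub>R W t)"
      unfolding W[of t] by (simp add: algebra_simps)
    then have "blinfun_apply (u' t (W t)) (l0 *\<^sub>R (x0 t - W t) + l1 *\<^sub>R (x1 t - W t)
        + l2 *\<^sub>R (x2 t - W t)) = 0"
      using W1 by (simp add: blinfun.bilinear_simps)
    then have "l0 *\<^sub>R r (x0 t) + l1 *\<^sub>R r (x1 t) + l2 *\<^sub>R r (x2 t)
       = l0 *\<^sub>R u t (x0 t) + l1 *\<^sub>R u t (x1 t) + l2 *\<^sub>R u t (x2 t) - (l0 *\<^sub>R u t (W t) + l1 *\<^sub>R u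
           t (W t) + l2 *\<^sub>R u t (W t))"
      by (simp add: r_def blinfun.bilinear_simps algebra_simps)
    then have eq: "l0 *\<^sub>R u t (x0 t) + l1 *\<^sub>R u t (x1 t) + l2 *\<^sub>R u t (x2 t) - u t (W t)
        = l0 *\<^sub>R r (x0 t) + l1 *\<^sub>R r (x1 t) + l2 *\<^sub>R r (x2 t)"
      unfolding W1 by simp
    have "norm (l0 *\<^sub>R r (x0 t) + l1 *\<^sub>R r (x1 t) + l2 *\<^sub>R r (x2 t))
      \<le> \<bar>l0\<bar> * (B2 * (norm (x0 t - W t))\<^sup>2) + \<bar>l1\<bar> * (B2 * (norm (x1 t - W t))\<^sup>2) + \<bar>l2\<bar> * (B2 *
          (norm (x2 t - W t))\<^sup>2)"
      by (intro norm_triangle_mono scaled r b)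
    also have "\<dots> = B2 * (\<bar>l0\<bar> * (norm (x0 t - W t))\<^sup>2 + \<bar>l1\<bar> * (norm (x1 t - W t))\<^sup>2
        + \<bar>l2\<bar> * (norm (x2 t - W t))\<^sup>2)" by (simp add: algebra_simps)
    also have "\<dots> \<le> B2 * E" using E t B by (intro mult_left_mono) auto
    finally have defect: "norm (l0 *\<^sub>R u t (x0 t) + l1 *\<^sub>R u t (x1 t) + l2 *\<^sub>R u t (x2 t)
        - u t (W t)) \<le> B2 * E"
      unfolding eq .
    have "norm (u t (z t) - u t (W t)) \<le> B1 * norm (z t - W t)" using lip a(1) t b Wb by blast
    with defect show "norm (u t (z t) - (l0 *\<^sub>R u t (x0 t) + l1 *\<^sub>R u t (x1 t) + l2 *\<^sub>R u t (x2 t)))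
        \<le> B1 * norm (z t - W t) + B2 * E"
      using norm_triangle_le_diff[of "u t (z t) - u t (W t)"
          "l0 *\<^sub>R u t (x0 t) + l1 *\<^sub>R u t (x1 t) + l2 *\<^sub>R u t (x2 t) - u t (W t)"]
      by (simp only: diff_diff_eq2 diff_add_cancel)
  qed (use st B short E in auto)
  then show ?thesis using z0 W[of s] by simp
qed

lemma flow_pathline:
  assumes "s \<in> {t0..t1}" "x \<in> \<Omega>"
  shows "pathline u D {t0..t1} (\<lambda>t. \<Psi> s t x)" "\<Psi> s s x = x"
  using flow assms by (auto simp: is_flow_def)

lemma flow_inverse:
  assumes "s \<in> {t0..t1}" "t \<in> {t0..t1}" "x \<in> \<Omega>" "\<Psi> s t x \<in> \<Omega>"
  shows "\<Psi> t s (\<Psi> s t x) = x"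
  using pathlines_unique[OF flow_pathline(1)[of t "\<Psi> s t x"] flow_pathline(1)[of s x], of t s]
    flow_pathline(2)[of s x] flow_pathline(2)[of t "\<Psi> s t x"] assms by simp

lemma flow_lipschitz:
  assumes "s \<in> {t0..t1}" "t \<in> {t0..t1}" "x \<in> \<Omega>" "y \<in> \<Omega>" "norm (x - y) \<le> \<rho> / 6"
  shows "norm (\<Psi> s t x - \<Psi> s t y) \<le> 2 * norm (x - y)"
  using pathlines_lipschitz[OF flow_pathline(1)[of s x] flow_pathline(1)[of s y], of s t y]
    flow_pathline(2)[of s] assms \<rho> by simp

lemma flow_continuous_on:
  assumes "s \<in> {t0..t1}" "t \<in> {t0..t1}"
  shows "continuous_on \<Omega> (\<Psi> s t)"
  unfolding continuous_on_iff
proof (intro ballI allI impI)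
  fix x and e :: real assume x: "x \<in> \<Omega>" and e: "e > 0"
  have "dist (\<Psi> s t x') (\<Psi> s t x) < e" if "x' \<in> \<Omega>" "dist x' x < min (\<rho> / 6) (e / 2)" for x'
    using flow_lipschitz[OF assms that(1) x] that(2) by (simp add: dist_norm)
  then show "\<exists>d>0. \<forall>x'\<in>\<Omega>. dist x' x < d \<longrightarrow> dist (\<Psi> s t x') (\<Psi> s t x) < e"
    using \<rho> e by (intro exI[of _ "min (\<rho> / 6) (e / 2)"]) auto
qed

lemma flow_affine_combination:
  assumes st: "s \<in> {t0..t1}" "t \<in> {t0..t1}"
    and pts: "p \<in> \<Omega>" "q \<in> \<Omega>" "r \<in> \<Omega>" "z \<in> \<Omega>"
    and near: "norm (q - p) \<le> \<rho> / 6" "norm (r - p) \<le> \<rho> / 6" "norm (z - p) \<le> \<rho> / 6"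
    and sum: "l0 + l1 + l2 = (1::real)" "\<bar>l0\<bar> + \<bar>l1\<bar> + \<bar>l2\<bar> \<le> 3"
    and z0: "z = l0 *\<^sub>R p + l1 *\<^sub>R q + l2 *\<^sub>R r"
    and E: "\<And>t W. \<lbrakk>t \<in> {t0..t1}; W = l0 *\<^sub>R \<Psi> s t p + l1 *\<^sub>R \<Psi> s t q + l2 *\<^sub>R \<Psi> s t r\<rbrakk>
        \<Longrightarrow> \<bar>l0\<bar> * (norm (\<Psi> s t p - W))\<^sup>2 + \<bar>l1\<bar> * (norm (\<Psi> s t q - W))\<^sup>2
          + \<bar>l2\<bar> * (norm (\<Psi> s t r - W))\<^sup>2 \<le> E" "E \<ge> 0"
  shows "norm (\<Psi> s t z - (l0 *\<^sub>R \<Psi> s t p + l1 *\<^sub>R \<Psi> s t q + l2 *\<^sub>R \<Psi> s t r))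
      \<le> 2 * (t1 - t0) * (B2 * E)"
  using pathlines_affine_combination[where W =
      "\<lambda>t. l0 *\<^sub>R \<Psi> s t p + l1 *\<^sub>R \<Psi> s t q + l2 *\<^sub>R \<Psi> s t r"
      and E = E and a = p,
      OF flow_pathline(1)[OF st(1) pts(1)] flow_pathline(1)[OF st(1) pts(2)] flow_pathline(1)[OF
          st(1) pts(3)]
        flow_pathline(1)[OF st(1) pts(4)] st pts(1) _ _ _ _ sum]
  using flow_pathline(2)[OF st(1)] pts near \<rho> z0 E by simp

lemma flow_almost_homogeneous:
  assumes st: "s \<in> {t0..t1}" "t \<in> {t0..t1}"
    and pts: "p \<in> \<Omega>" "q \<in> \<Omega>" "p + \<alpha> *\<^sub>R (q - p) \<in> \<Omega>" and near: "norm (q - p) \<le> \<rho> / 6"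
    and \<alpha>: "0 \<le> \<alpha>" "\<alpha> \<le> 1"
  shows "norm (\<Psi> s t (p + \<alpha> *\<^sub>R (q - p)) - ((1 - \<alpha>) *\<^sub>R \<Psi> s t p + \<alpha> *\<^sub>R \<Psi> s t q))
    \<le> 8 * (t1 - t0) * B2 * \<alpha> * (norm (q - p))\<^sup>2"
proof -
  let ?E = "4 * \<alpha> * (norm (q - p))\<^sup>2"
  have "norm (\<Psi> s t (p + \<alpha> *\<^sub>R (q - p)) - ((1 - \<alpha>) *\<^sub>R \<Psi> s t p + \<alpha> *\<^sub>R \<Psi> s t q + 0 *\<^sub>R \<Psi> s t p))
     \<le> 2 * (t1 - t0) * (B2 * ?E)"
  proof (rule flow_affine_combination[OF st pts(1,2,1,3) near])
    show "norm (p + \<alpha> *\<^sub>R (q - p) - p) \<le> \<rho> / 6"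
      using \<alpha> near mult_left_le_one_le[of "norm (q - p)" \<alpha>] by simp
    fix t W assume t: "t \<in> {t0..t1}" and W:
        "W = (1 - \<alpha>) *\<^sub>R \<Psi> s t p + \<alpha> *\<^sub>R \<Psi> s t q + 0 *\<^sub>R \<Psi> s t p"
    let ?d = "\<Psi> s t q - \<Psi> s t p"
    have "\<Psi> s t p - W = (- \<alpha>) *\<^sub>R ?d" "\<Psi> s t q - W = (1 - \<alpha>) *\<^sub>R ?d" unfolding W
        by (simp_all add: algebra_simps)
    then have "\<bar>1 - \<alpha>\<bar> * (norm (\<Psi> s t p - W))\<^sup>2 + \<bar>\<alpha>\<bar> * (norm (\<Psi> s t q - W))\<^sup>2
        + \<bar>0\<bar> * (norm (\<Psi> s t p - W))\<^sup>2
      = (1 - \<alpha>) * (\<alpha> * norm ?d)\<^sup>2 + \<alpha> * ((1 - \<alpha>) * norm ?d)\<^sup>2" using \<alpha> by simp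
    also have "\<dots> = (1 - \<alpha>) * (\<alpha> * (norm ?d)\<^sup>2)"
      by (simp add: power2_eq_square algebra_simps)
    also have "\<dots> \<le> \<alpha> * (norm ?d)\<^sup>2" using \<alpha> by (intro mult_left_le_one_le) auto
    also have "\<dots> \<le> \<alpha> * (2 * norm (q - p))\<^sup>2"
      using flow_lipschitz[OF st(1) t pts(2,1) near] \<alpha> by (intro mult_left_mono power_mono) auto
    finally show "\<bar>1 - \<alpha>\<bar> * (norm (\<Psi> s t p - W))\<^sup>2 + \<bar>\<alpha>\<bar> * (norm (\<Psi> s t q - W))\<^sup>2
        + \<bar>0\<bar> * (norm (\<Psi> s t p - W))\<^sup>2 \<le> ?E"
      by (simp add: power_mult_distrib)
  qed (use \<alpha> \<rho> in \<open>auto simp: algebra_simps\<close>)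
  then show ?thesis by (simp add: algebra_simps)
qed

lemma flow_almost_additive:
  assumes st: "s \<in> {t0..t1}" "t \<in> {t0..t1}"
    and pts: "p \<in> \<Omega>" "p + v \<in> \<Omega>" "p + w \<in> \<Omega>" "p + v + w \<in> \<Omega>" and near: "norm v + norm w \<le> \<rho> / 6"
  shows "norm (\<Psi> s t (p + v + w) - \<Psi> s t (p + v) - \<Psi> s t (p + w) + \<Psi> s t p)
    \<le> 24 * (t1 - t0) * B2 * (norm v + norm w)\<^sup>2"
proof -
  let ?N = "norm v + norm w"
  let ?E = "12 * ?N\<^sup>2"
  have n: "norm v \<le> \<rho> / 6" "norm w \<le> \<rho> / 6" "norm (v + w) \<le> \<rho> / 6"
    using near norm_triangle_ineq[of v w] norm_ge_zero[of v] norm_ge_zero[of w] by linarith+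
  have "norm (\<Psi> s t (p + v + w) - ((- 1) *\<^sub>R \<Psi> s t p + 1 *\<^sub>R \<Psi> s t (p + v) + 1 *\<^sub>R \<Psi> s t (p + w)))
     \<le> 2 * (t1 - t0) * (B2 * ?E)"
  proof (rule flow_affine_combination[OF st pts])
    fix t W assume t: "t \<in> {t0..t1}" and W:
        "W = (- 1) *\<^sub>R \<Psi> s t p + 1 *\<^sub>R \<Psi> s t (p + v) + 1 *\<^sub>R \<Psi> s t (p + w)"
    have v: "norm (\<Psi> s t p - \<Psi> s t (p + v)) \<le> 2 * norm v"
        "norm (\<Psi> s t p - \<Psi> s t (p + w)) \<le> 2 * norm w"
      using flow_lipschitz[OF st(1) t pts(1,2)] flow_lipschitz[OF st(1) t pts(1,3)] n by auto
    have W': "\<Psi> s t p - W = (\<Psi> s t p - \<Psi> s t (p + v)) + (\<Psi> s t p - \<Psi> s t (p + w))"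
      "\<Psi> s t (p + v) - W = \<Psi> s t p - \<Psi> s t (p + w)" "\<Psi> s t (p + w) - W = \<Psi> s t p - \<Psi> s t (p + v)"
      by (simp_all add: W)
    have "norm (\<Psi> s t p - W) \<le> 2 * ?N"
      unfolding W' using norm_triangle_mono[OF v] by simp
    moreover have "norm (\<Psi> s t (p + v) - W) \<le> 2 * ?N" "norm (\<Psi> s t (p + w) - W) \<le> 2 * ?N"
      unfolding W' using v by (simp_all add: algebra_simps add_increasing2 add_increasing)
    ultimately have "(norm (\<Psi> s t p - W))\<^sup>2 \<le> (2 * ?N)\<^sup>2"
        "(norm (\<Psi> s t (p + v) - W))\<^sup>2 \<le> (2 * ?N)\<^sup>2"
      "(norm (\<Psi> s t (p + w) - W))\<^sup>2 \<le> (2 * ?N)\<^sup>2" by (auto intro!: power_mono)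
    then have "(norm (\<Psi> s t p - W))\<^sup>2 + (norm (\<Psi> s t (p + v) - W))\<^sup>2 + (norm (\<Psi> s t (p + w)
        - W))\<^sup>2 \<le> 3 * (2 * ?N)\<^sup>2"
      by linarith
    then show "\<bar>- 1\<bar> * (norm (\<Psi> s t p - W))\<^sup>2 + \<bar>1\<bar> * (norm (\<Psi> s t (p + v) - W))\<^sup>2
        + \<bar>1\<bar> * (norm (\<Psi> s t (p + w) - W))\<^sup>2 \<le> ?E"
      unfolding power_mult_distrib by simp
  qed (use n in \<open>auto simp: algebra_simps\<close>)
  then show ?thesis by (simp add: algebra_simps)
qed

text \<open>
  The cross product of two vectors \<open>a\<close> and \<open>b\<close> is \<open>Im (cnj a * b)\<close>. Let \<open>A\<close> be the spatial
  derivative of the velocity. The first-order part \<open>A a \<times> b + a \<times> A b = trace A * (a \<times> b)\<close> of the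
  time derivative of the cross product vanishes, and the remainder is of third order in \<open>l\<close>.
\<close>

lemma flow_area_element:
  assumes st: "s \<in> {t0..t1}" "t \<in> {t0..t1}"
    and pts: "p \<in> \<Omega>" "p + of_real l \<in> \<Omega>" "p + of_real l * \<i> \<in> \<Omega>" and l: "0 < l" "l \<le> \<rho> / 6"
  shows "\<bar>Im (cnj (\<Psi> s t (p + of_real l) - \<Psi> s t p) * (\<Psi> s t (p + of_real l * \<i>) - \<Psi> s t p)) - l\<^sup>2\<bar>
    \<le> 16 * B2 * (t1 - t0) * l ^ 3"
proof -
  let ?x = "\<lambda>t. \<Psi> s t p" and ?y = "\<lambda>t. \<Psi> s t (p + of_real l)"
      and ?z = "\<lambda>t. \<Psi> s t (p + of_real l * \<i>)"
  let ?c = "\<lambda>v w. Im (cnj v * w)"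
  let ?f = "\<lambda>t. ?c (?y t - ?x t) (?z t - ?x t)"
  \<comment> \<open>The bound on displacements is for complex-valued curves.\<close>
  define F where "F t = complex_of_real (?f t)" for t
  define F' where "F' t = complex_of_real (?c (u t (?y t) - u t (?x t)) (?z t - ?x t) + ?c (?y t
      - ?x t) (u t (?z t) - u t (?x t)))" for t
  have "norm (F t - F s) \<le> (t1 - t0) * (16 * B2 * l ^ 3)"
  proof (rule displacement_bound[OF st])
    fix t assume t: "t \<in> {t0..t1}"
    have d: "(?x has_vector_derivative u t (?x t)) (at t within {t0..t1})"
      "(?y has_vector_derivative u t (?y t)) (at t within {t0..t1})"
      "(?z has_vector_derivative u t (?z t)) (at t within {t0..t1})"
      using flow_pathline(1)[OF st(1)] pts t by (auto simp: pathline_def)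
    show "(F has_vector_derivative F' t) (at t within {t0..t1})"
      unfolding F_def F'_def
      by (rule has_vector_derivative_eq_rhs,
          (rule bounded_linear.has_vector_derivative[OF bounded_linear_of_real]
            bounded_linear.has_vector_derivative[OF bounded_linear_Im]
            has_vector_derivative_mult bounded_linear.has_vector_derivative[OF bounded_linear_cnj]
                has_vector_derivative_diff d)+)
        (simp add: algebra_simps)
    let ?A = "blinfun_apply (u' t (?x t))"
    define a b where "a = ?y t - ?x t" and "b = ?z t - ?x t"
    define ra rb where "ra = u t (?y t) - u t (?x t) - ?A a"
        and "rb = u t (?z t) - u t (?x t) - ?A b"
    have na: "norm a \<le> 2 * l" and nb: "norm b \<le> 2 * l"
      using flow_lipschitz[OF st(1) t pts(2,1)] flow_lipschitz[OF st(1) t pts(3,1)] l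
      by (auto simp: a_def b_def norm_mult)
    have near: "?x t \<in> cball p \<rho>" "?y t \<in> cball p \<rho>" "?z t \<in> cball p \<rho>"
      using pathline_near[OF flow_pathline(1)[OF st(1) pts(1)] st(1) t, of p]
        pathline_near[OF flow_pathline(1)[OF st(1) pts(2)] st(1) t, of p]
        pathline_near[OF flow_pathline(1)[OF st(1) pts(3)] st(1) t, of p]
        flow_pathline(2)[OF st(1)] pts l \<rho>
      by (auto simp: dist_norm norm_minus_commute norm_mult)
    have ra: "norm ra \<le> B2 * (2 * l)\<^sup>2" and rb: "norm rb \<le> B2 * (2 * l)\<^sup>2"
    proof -
      have "norm ra \<le> B2 * (norm a)\<^sup>2" "norm rb \<le> B2 * (norm b)\<^sup>2"
        unfolding ra_def rb_def a_def b_def using taylor[OF pts(1) t] near by blast+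
      moreover have "B2 * (norm a)\<^sup>2 \<le> B2 * (2 * l)\<^sup>2" "B2 * (norm b)\<^sup>2 \<le> B2 * (2 * l)\<^sup>2"
        by (intro mult_left_mono power_mono na nb B norm_ge_zero)+
      ultimately show "norm ra \<le> B2 * (2 * l)\<^sup>2" "norm rb \<le> B2 * (2 * l)\<^sup>2" by linarith+
    qed
    have "?x t \<in> D" using flow_pathline(1)[OF st(1) pts(1)] t by (simp add: pathline_def)
    then have tr: "Im (?A \<i>) = - Re (?A 1)" using trace0[OF t] by fastforce
    have lin: "?A v = Re v *\<^sub>R ?A 1 + Im v *\<^sub>R ?A \<i>" for v
    proof -
      have "v = Re v *\<^sub>R 1 + Im v *\<^sub>R \<i>" by (simp add: complex_eq_iff)
      then show ?thesis by (metis blinfun.add_right blinfun.scaleR_right)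
    qed
    have A0: "?c (?A a) b + ?c a (?A b) = 0"
      unfolding lin[of a] lin[of b] by (simp add: tr algebra_simps)
    have "F' t = complex_of_real (?c (?A a + ra) b + ?c a (?A b + rb))"
      by (simp add: F'_def a_def b_def ra_def rb_def)
    also have "?c (?A a + ra) b + ?c a (?A b + rb)
        = (?c (?A a) b + ?c a (?A b)) + (?c ra b + ?c a rb)"
      by (simp add: algebra_simps)
    also have "\<dots> = ?c ra b + ?c a rb" unfolding A0 by simp
    finally have "norm (F' t) \<le> \<bar>?c ra b\<bar> + \<bar>?c a rb\<bar>" by (simp only: norm_of_real)
    also have "\<dots> \<le> norm ra * norm b + norm a * norm rb"
      by (intro add_mono order_trans[OF abs_Im_le_cmod]) (simp_all add: norm_mult)
    also have "\<dots> \<le> (B2 * (2 * l)\<^sup>2) * (2 * l) + (2 * l) * (B2 * (2 * l)\<^sup>2)"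
      using na nb ra rb l B by (intro add_mono mult_mono) auto
    also have "\<dots> = 16 * B2 * l ^ 3" by (simp add: power2_eq_square power3_eq_cube)
    finally show "norm (F' t) \<le> 16 * B2 * l ^ 3" .
  qed
  moreover have "F s = of_real (l\<^sup>2)"
    using flow_pathline(2)[OF st(1)] pts by (simp add: F_def power2_eq_square)
  then have "F t - F s = of_real (?f t - l\<^sup>2)" by (simp only: F_def of_real_diff)
  then have "norm (F t - F s) = \<bar>?f t - l\<^sup>2\<bar>" by (simp only: norm_of_real)
  ultimately show ?thesis by (simp only: mult.assoc mult.left_commute)
qed

text \<open>
  The last conclusion says that the Jacobian determinant is one: \<open>m1\<close> and \<open>m2\<close> are the columns of
  the Jacobian matrix.
\<close>

lemma flow_differentiable:
  assumes st: "s \<in> {t0..t1}" "t \<in> {t0..t1}" and p: "p \<in> interior \<Omega>"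
  obtains m1 m2 where "(\<Psi> s t has_derivative (\<lambda>v. Re v *\<^sub>R m1 + Im v *\<^sub>R m2)) (at p)"
    "Im (cnj m1 * m2) = 1"
proof -
  let ?f = "\<Psi> s t"
  obtain \<epsilon>0 where \<epsilon>0: "\<epsilon>0 > 0" "ball p \<epsilon>0 \<subseteq> \<Omega>" using p by (auto simp: mem_interior)
  define \<epsilon> where "\<epsilon> = min \<epsilon>0 (\<rho> / 6)"
  have \<epsilon>: "\<epsilon> > 0" "\<epsilon> \<le> \<rho> / 6" using \<epsilon>0 \<rho> by (auto simp: \<epsilon>_def)
  have \<Omega>: "p + v \<in> \<Omega>" if "norm v < \<epsilon>" for v
    using that \<epsilon>0 by (auto simp: \<epsilon>_def dist_norm intro!: subsetD[OF \<epsilon>0(2)])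
  have p\<Omega>: "p \<in> \<Omega>" using \<Omega>[of 0] \<epsilon> by simp
  define K where "K = 24 * (t1 - t0) * B2"
  have K: "K \<ge> 0" using t01 B by (simp add: K_def)
  obtain m1 m2 where m: "(?f has_derivative (\<lambda>v. Re v *\<^sub>R m1 + Im v *\<^sub>R m2)) (at p)"
  proof (rule differentiable_of_almost_linear[OF \<epsilon>(1) K, of ?f p])
    fix v :: complex and \<alpha> :: real assume v: "norm v < \<epsilon>" and \<alpha>: "0 < \<alpha>" "\<alpha> \<le> 1"
    have "norm (\<alpha> *\<^sub>R v) \<le> norm v" using \<alpha> mult_left_le_one_le[of "norm v" \<alpha>] by simp
    then have "p + \<alpha> *\<^sub>R v \<in> \<Omega>" using v by (intro \<Omega>) auto
    then have "norm (?f (p + \<alpha> *\<^sub>R v) - ((1 - \<alpha>) *\<^sub>R ?f p + \<alpha> *\<^sub>R ?f (p + v)))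
        \<le> 8 * (t1 - t0) * B2 * \<alpha> * (norm v)\<^sup>2"
      using flow_almost_homogeneous[OF st p\<Omega> \<Omega>[OF v], of \<alpha>] v \<alpha> \<epsilon> by simp
    also have "\<dots> = (8 * (t1 - t0) * B2) * (\<alpha> * (norm v)\<^sup>2)" by simp
    also have "\<dots> \<le> K * (\<alpha> * (norm v)\<^sup>2)" unfolding K_def using t01 B \<alpha>
        by (intro mult_right_mono) auto
    finally show "norm (?f (p + \<alpha> *\<^sub>R v) - ?f p - \<alpha> *\<^sub>R (?f (p + v) - ?f p)) \<le> K * \<alpha> * (norm v)\<^sup>2"
      by (simp add: algebra_simps)
  next
    fix v w :: complex assume vw: "norm v + norm w < \<epsilon>"
    have "norm v < \<epsilon>" "norm w < \<epsilon>" "norm (v + w) < \<epsilon>"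
      using vw norm_triangle_ineq[of v w] norm_ge_zero[of v] norm_ge_zero[of w] by linarith+
    then show "norm (?f (p + v + w) - ?f (p + v) - ?f (p + w) + ?f p) \<le> K * (norm v + norm w)\<^sup>2"
      using flow_almost_additive[OF st p\<Omega> \<Omega>[of v] \<Omega>[of w]] \<Omega>[of "v + w"] vw \<epsilon>
          by (simp add: K_def add.assoc)
  qed (rule that)
  define g where "g e l = (?f (p + of_real l * e) - ?f p) /\<^sub>R l" for e l
  have glim: "((g e) \<longlongrightarrow> Re e *\<^sub>R m1 + Im e *\<^sub>R m2) (at_right 0)" (is "(_ \<longlongrightarrow> ?m) _") for e
  proof -
    have "((\<lambda>l. p + of_real l * e) has_vector_derivative e) (at_right 0)"
      by (auto intro!: derivative_eq_intros simp: has_vector_derivative_def scaleR_conv_of_real)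
    then have "((\<lambda>l. ?f (p + of_real l * e)) has_derivative (\<lambda>h. Re (h *\<^sub>R e) *\<^sub>R m1
        + Im (h *\<^sub>R e) *\<^sub>R m2)) (at_right 0)"
      unfolding has_vector_derivative_def
      by (rule has_derivative_compose) (use m in simp)
    then have "((\<lambda>l. ((?f (p + of_real l * e) - ?f p) - l *\<^sub>R ?m) /\<^sub>R norm l) \<longlongrightarrow> 0) (at_right 0)"
      by (simp add: has_derivative_at_within scaleR_add_right)
    moreover have "eventually (\<lambda>l. ((?f (p + of_real l * e) - ?f p) - l *\<^sub>R ?m) /\<^sub>R norm l
        = g e l - ?m) (at_right (0::real))"
      using eventually_at_right_less[of 0]
      by eventually_elim (simp add: g_def scaleR_diff_right)
    ultimately have "((\<lambda>l. g e l - ?m) \<longlongrightarrow> 0) (at_right 0)" by (rule Lim_transform_eventually)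
    then show ?thesis by (rule LIM_zero_cancel)
  qed
  have "((\<lambda>l. Im (cnj (g 1 l) * g \<i> l)) \<longlongrightarrow> Im (cnj (Re 1 *\<^sub>R m1 + Im 1 *\<^sub>R m2) * (Re \<i> *\<^sub>R m1
      + Im \<i> *\<^sub>R m2))) (at_right 0)"
    by (intro tendsto_intros glim)
  then have lim1: "((\<lambda>l. Im (cnj (g 1 l) * g \<i> l)) \<longlongrightarrow> Im (cnj m1 * m2)) (at_right 0)" by simp
  have "((\<lambda>l. Im (cnj (g 1 l) * g \<i> l) - 1) \<longlongrightarrow> 0) (at_right 0)"
  proof (rule Lim_null_comparison)
    show "((\<lambda>l. 16 * B2 * (t1 - t0) * l) \<longlongrightarrow> 0) (at_right (0::real))"
      by (auto intro!: tendsto_eq_intros)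
    have "eventually (\<lambda>l. 0 < l \<and> l < \<epsilon>) (at_right (0::real))"
      using \<epsilon> by (auto simp: eventually_at_right intro!: exI[of _ \<epsilon>])
    then show "eventually (\<lambda>l. norm (Im (cnj (g 1 l) * g \<i> l) - 1)
        \<le> 16 * B2 * (t1 - t0) * l) (at_right 0)"
    proof eventually_elim
      case (elim l)
      have "Im (cnj (g 1 l) * g \<i> l) - 1
        = (Im (cnj (?f (p + of_real l) - ?f p) * (?f (p + of_real l * \<i>) - ?f p)) - l\<^sup>2) / l\<^sup>2"
        using elim by (simp add: g_def field_simps power2_eq_square)
      also have "\<bar>\<dots>\<bar> \<le> (16 * B2 * (t1 - t0) * l ^ 3) / l\<^sup>2"
        unfolding abs_divide using elim \<epsilon> flow_area_element[OF st p\<Omega>, of l] \<Omega>[of "of_real l"] \<Omega>[of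
            "of_real l * \<i>"]
        by (simp add: divide_right_mono norm_mult)
      also have "\<dots> = 16 * B2 * (t1 - t0) * l" using elim
          by (simp add: power2_eq_square power3_eq_cube)
      finally show ?case by simp
    qed
  qed
  then have "((\<lambda>l. Im (cnj (g 1 l) * g \<i> l)) \<longlongrightarrow> 1) (at_right 0)" by (simp add: LIM_zero_iff)
  with lim1 have "Im (cnj m1 * m2) = 1" by (rule tendsto_unique[rotated]) simp
  with m show ?thesis by (rule that)
qed

end

section \<open>Regions enclosed by closed curves\<close>

text \<open>
  The closed region bounded by a closed curve according to the nonzero winding number rule.
  Polygons are the case of a closed polygonal line.
\<close>

definition enclosed_region :: "(real \<Rightarrow> complex) \<Rightarrow> complex set" where
  "enclosed_region \<gamma> = path_image \<gamma> \<union> {z. z \<notin> path_image \<gamma> \<and> winding_number \<gamma> z \<noteq> 0}"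

text \<open>
  The union of the closed balls of radius \<open>\<eta>\<close> around the points of \<open>S\<close>; for compact \<open>S\<close>, the
  closed \<open>\<eta>\<close>-neighbourhood.
\<close>

definition tube :: "complex set \<Rightarrow> real \<Rightarrow> complex set" where
  "tube S \<eta> = (\<Union>x\<in>S. cball x \<eta>)"

lemma polygon_eq_enclosed_region: "polygon vs = enclosed_region (boundary_path vs)"
  by (simp add: polygon_def enclosed_region_def)

lemma compact_enclosed_region:
  assumes "path \<gamma>" "pathfinish \<gamma> = pathstart \<gamma>"
  shows "compact (enclosed_region \<gamma>)"
proof -
  have "enclosed_region \<gamma> = - {z. z \<notin> path_image \<gamma> \<and> winding_number \<gamma> z = 0}"
    by (auto simp: enclosed_region_def)
  then have "closed (enclosed_region \<gamma>)"
    using open_winding_number_levelsets[OF assms] by (simp add: closed_Compl)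
  moreover have "bounded (enclosed_region \<gamma>)"
  proof -
    obtain B where B: "\<And>z. B \<le> norm z \<Longrightarrow> winding_number \<gamma> z = 0"
      using winding_number_zero_at_infinity[OF assms] by blast
    obtain B' where B': "\<And>z. z \<in> path_image \<gamma> \<Longrightarrow> norm z \<le> B'"
      using bounded_path_image[OF assms(1)] by (auto simp: bounded_iff)
    have "norm z \<le> max B B'" if "z \<in> enclosed_region \<gamma>" for z
      using that B[of z] B'[of z] by (fastforce simp: enclosed_region_def)
    then show ?thesis by (auto simp: bounded_iff)
  qed
  ultimately show ?thesis by (simp add: compact_eq_bounded_closed)
qed

lemma sym_diff_enclosed_region_subset_tube:
  assumes g: "path g" "pathfinish g = pathstart g" and k: "path k" "pathfinish k = pathstart k"
    and close: "\<And>t. t \<in> {0..1} \<Longrightarrow> norm (g t - k t) \<le> \<eta>"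
  shows "sym_diff (enclosed_region g) (enclosed_region k) \<subseteq> tube (path_image g) \<eta>"
proof -
  have "z \<in> enclosed_region g \<longleftrightarrow> z \<in> enclosed_region k" if z: "z \<notin> tube (path_image g) \<eta>" for z
  proof -
    have seg: "z \<notin> closed_segment (g t) (k t)" if t: "t \<in> {0..1}" for t
    proof
      assume "z \<in> closed_segment (g t) (k t)"
      then have "norm (z - g t) \<le> norm (k t - g t)" by (rule segment_bound1)
      also have "\<dots> \<le> \<eta>" using close[OF t] by (simp add: norm_minus_commute)
      finally have "z \<in> cball (g t) \<eta>" by (simp add: dist_norm norm_minus_commute)
      with z t show False by (auto simp: tube_def path_image_def)
    qed
    then have "homotopic_loops (- {z}) g k"
      using g k by (intro homotopic_loops_linear) auto
    then have "winding_number g z = winding_number k z"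
      by (rule winding_number_homotopic_loops)
    moreover have "z \<notin> path_image g" "z \<notin> path_image k"
      using seg unfolding path_image_def by (metis ends_in_segment imageE)+
    ultimately show ?thesis by (simp add: enclosed_region_def)
  qed
  then show ?thesis by auto
qed

lemma enclosed_region_simple:
  assumes "simple_path \<gamma>" "pathfinish \<gamma> = pathstart \<gamma>"
  shows "enclosed_region \<gamma> = path_image \<gamma> \<union> inside (path_image \<gamma>)"
proof -
  have "winding_number \<gamma> z \<noteq> 0" if "z \<in> inside (path_image \<gamma>)" for z
    using simple_closed_path_winding_number_inside[OF assms(1)] that
    by (metis zero_neq_neg_one zero_neq_one)
  moreover have "winding_number \<gamma> z = 0" if "z \<in> outside (path_image \<gamma>)" for z
    using winding_number_zero_in_outside assms simple_path_imp_path that by blast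
  moreover have "z \<in> path_image \<gamma> \<or> z \<in> inside (path_image \<gamma>) \<or> z \<in> outside (path_image \<gamma>)" for z
    using inside_Un_outside[of "path_image \<gamma>"] by blast
  moreover have "z \<notin> path_image \<gamma>" if "z \<in> inside (path_image \<gamma>)" for z
    using inside_no_overlap that by blast
  ultimately show ?thesis unfolding enclosed_region_def by blast
qed

text \<open>
  The image of the inside of \<open>\<gamma>\<close> is open by invariance of domain, and it is relatively closed in
  the complement of the image curve. It is therefore a bounded component of that complement, and
  by the Jordan curve theorem there is only one.
\<close>

lemma image_enclosed_region:
  assumes \<gamma>: "simple_path \<gamma>" "pathfinish \<gamma> = pathstart \<gamma>"
    and f: "continuous_on (enclosed_region \<gamma>) f" "inj_on f (enclosed_region \<gamma>)"
  shows "f ` enclosed_region \<gamma> = enclosed_region (f \<circ> \<gamma>)"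
    and "f ` inside (path_image \<gamma>) = inside (path_image (f \<circ> \<gamma>))"
proof -
  let ?I = "inside (path_image \<gamma>)" and ?J = "inside (path_image (f \<circ> \<gamma>))"
  have path: "path \<gamma>" by (simp add: \<gamma> simple_path_imp_path)
  note R = enclosed_region_simple[OF \<gamma>]
  have Isub: "?I \<subseteq> enclosed_region \<gamma>" and Psub: "path_image \<gamma> \<subseteq> enclosed_region \<gamma>" using R by auto
  have JI: "?I \<noteq> {}" "open ?I" "connected ?I" "bounded ?I" "frontier ?I = path_image \<gamma>"
    using Jordan_inside_outside[OF \<gamma>] by auto
  have pi: "path_image (f \<circ> \<gamma>) = f ` path_image \<gamma>" by (simp add: path_image_def image_comp)
  have sp: "simple_path (f \<circ> \<gamma>)"
    using simple_path_continuous_image[OF \<gamma>(1)] f Psub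
    by (meson continuous_on_subset inj_on_subset)
  have cl: "pathfinish (f \<circ> \<gamma>) = pathstart (f \<circ> \<gamma>)"
    using \<gamma>(2) by (simp add: pathfinish_def pathstart_def)
  have JJ: "connected ?J" "open ?J" "?J \<noteq> {}"
    using Jordan_inside_outside[OF sp cl] by auto
  have opn: "open (f ` ?I)"
    using f Isub JI by (intro invariance_of_domain) (auto intro: continuous_on_subset inj_on_subset)
  have disj: "f ` ?I \<inter> f ` path_image \<gamma> = {}"
    using inj_on_image_Int[OF f(2) Isub Psub] inside_no_overlap[of "path_image \<gamma>"]
    by (simp add: Int_commute)
  have cpt: "compact (enclosed_region \<gamma>)" by (simp add: compact_enclosed_region path \<gamma>)
  have comp: "compact (f ` enclosed_region \<gamma>)"
    using compact_continuous_image f cpt by blast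
  have eqR: "f ` enclosed_region \<gamma> = f ` path_image \<gamma> \<union> f ` ?I" using R by auto
  have conn: "connected (f ` ?I)"
    using JI f Isub by (intro connected_continuous_image) (auto intro: continuous_on_subset)
  have clo: "closed (f ` enclosed_region \<gamma>)" using comp by (rule compact_imp_closed)
  \<comment> \<open>A connected set that avoids the image curve lies inside or outside the image of the inside.\<close>
  have dich: "S \<subseteq> f ` ?I \<or> S \<inter> f ` ?I = {}" if "connected S" "S \<inter> f ` path_image \<gamma> = {}" for S
  proof -
    have S: "S \<subseteq> f ` ?I \<union> (- f ` enclosed_region \<gamma>)" using that(2) eqR by auto
    have "open (- f ` enclosed_region \<gamma>)" using clo by (simp add: open_Compl)
    moreover have "f ` ?I \<inter> (- f ` enclosed_region \<gamma>) \<inter> S = {}" using eqR by blast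
    ultimately have "f ` ?I \<inter> S = {} \<or> (- f ` enclosed_region \<gamma>) \<inter> S = {}"
      using connectedD[OF that(1) opn] S by blast
    then show ?thesis using S by blast
  qed
  have sub: "f ` ?I \<subseteq> ?J"
  proof
    fix z assume z: "z \<in> f ` ?I"
    have zn: "z \<notin> path_image (f \<circ> \<gamma>)" using z disj pi by auto
    have "connected_component_set (- path_image (f \<circ> \<gamma>)) z \<subseteq> f ` ?I"
    proof -
      have "z \<in> connected_component_set (- path_image (f \<circ> \<gamma>)) z"
        using zn by (simp add: connected_component_refl)
      moreover have "connected_component_set (- path_image (f \<circ> \<gamma>)) z \<inter> f ` path_image \<gamma> = {}"
        using connected_component_subset[of "- path_image (f \<circ> \<gamma>)" z] pi by auto
      ultimately show ?thesis using dich[OF connected_connected_component] z by blast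
    qed
    moreover have "bounded (f ` ?I)" using compact_imp_bounded[OF comp] eqR
        by (simp add: bounded_Un)
    ultimately have "bounded (connected_component_set (- path_image (f \<circ> \<gamma>)) z)"
      using bounded_subset by blast
    with zn show "z \<in> ?J" unfolding inside_def by blast
  qed
  have "?J \<inter> f ` path_image \<gamma> = {}" using inside_no_overlap[of "path_image (f \<circ> \<gamma>)"] pi by auto
  then have "?J \<subseteq> f ` ?I" using dich[OF JJ(1)] sub JI(1) by blast
  with sub show J: "f ` ?I = ?J" by auto
  show "f ` enclosed_region \<gamma> = enclosed_region (f \<circ> \<gamma>)"
    unfolding enclosed_region_simple[OF sp cl] eqR J pi ..
qed

section \<open>Area of neighbourhoods of polygonal lines\<close>

lemma compact_tube: "compact S \<Longrightarrow> compact (tube S \<eta>)"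
  unfolding tube_def by (rule compact_minkowski_sum_cball)

lemma tube_Un: "tube (S \<union> T) \<eta> = tube S \<eta> \<union> tube T \<eta>"
  by (auto simp: tube_def)

lemma measure_cball_le:
  fixes x :: complex assumes "r \<ge> 0"
  shows "M0 (cball x r) \<le> 4 * r\<^sup>2"
proof -
  have sub: "cball x r \<subseteq> cbox (x - Complex r r) (x + Complex r r)"
  proof
    fix z assume "z \<in> cball x r"
    then have "norm (z - x) \<le> r" by (simp add: dist_norm norm_minus_commute)
    then have "\<bar>Re (z - x)\<bar> \<le> r" "\<bar>Im (z - x)\<bar> \<le> r"
      using abs_Re_le_cmod abs_Im_le_cmod order_trans by blast+
    then show "z \<in> cbox (x - Complex r r) (x + Complex r r)"
      by (auto simp: in_cbox_complex_iff abs_le_iff)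
  qed
  have "M0 (cball x r) \<le> M0 (cbox (x - Complex r r) (x + Complex r r))"
    by (intro measure_mono_fmeasurable sub) auto
  also have "\<dots> = 4 * r\<^sup>2"
    using assms by (simp add: content_cbox_if box_eq_empty Basis_complex_def inner_complex_def
        power2_eq_square)
  finally show ?thesis .
qed

text \<open>
  The segment is divided into parts of length at most \<open>\<eta>\<close>; balls of radius \<open>2 * \<eta>\<close> around the
  division points cover the tube. With \<open>n \<le> l / \<eta> + 2\<close> parts this gives the bound.
\<close>

lemma measure_tube_segment_le:
  assumes ab: "norm (b - a) \<le> l" and \<eta>: "\<eta> > 0"
  shows "M0 (tube (closed_segment a b) \<eta>) \<le> 16 * l * \<eta> + 32 * \<eta>\<^sup>2"
proof -
  define n where "n = nat \<lceil>l / \<eta>\<rceil> + 1"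
  have l: "l \<ge> 0" using ab norm_ge_zero order_trans by blast
  have n: "real n \<le> l / \<eta> + 2" "l / \<eta> \<le> real n" "n > 0"
    using l \<eta> unfolding n_def by (auto simp: of_nat_nat) linarith+
  let ?p = "\<lambda>k. a + (real k / real n) *\<^sub>R (b - a)"
  have sub: "tube (closed_segment a b) \<eta> \<subseteq> (\<Union>k\<in>{1..n}. cball (?p k) (2 * \<eta>))"
  proof
    fix z assume "z \<in> tube (closed_segment a b) \<eta>"
    then obtain w where w: "w \<in> closed_segment a b" "norm (z - w) \<le> \<eta>"
      by (auto simp: tube_def dist_norm norm_minus_commute)
    then obtain u where u: "0 \<le> u" "u \<le> 1" "w = a + u *\<^sub>R (b - a)"
      by (auto simp: closed_segment_def algebra_simps)
    define k where "k = nat \<lceil>u * n\<rceil>"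
    \<comment> \<open>The start point of the segment is not among the centres; its neighbour takes its place.\<close>
    define k' where "k' = (if k = 0 then 1 else k)"
    have "\<lceil>u * n\<rceil> \<le> int n" using u n by (simp add: ceiling_le_iff mult_left_le_one_le)
    then have k: "k \<le> n" "\<bar>real k' - u * n\<bar> \<le> 1" "k' \<in> {1..n}"
      using u n unfolding k'_def k_def by (auto simp: of_nat_nat) linarith+
    have "?p k' - w = (real k' / n - u) *\<^sub>R (b - a)" using u by (simp add: algebra_simps)
    then have "norm (?p k' - w) = \<bar>real k' / n - u\<bar> * norm (b - a)" by simp
    also have "\<bar>real k' / n - u\<bar> = \<bar>real k' - u * n\<bar> / n" using n
        by (simp add: field_simps abs_divide)
    also have "\<bar>real k' - u * n\<bar> / n * norm (b - a) \<le> 1 / n * l"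
      using k n ab by (intro mult_mono divide_right_mono) auto
    also have "\<dots> \<le> \<eta>" using n \<eta> by (simp add: field_simps)
    finally have "dist (?p k') w \<le> \<eta>" by (simp add: dist_norm)
    moreover have "dist w z \<le> \<eta>" using w(2) by (simp add: dist_norm norm_minus_commute)
    ultimately have "dist (?p k') z \<le> 2 * \<eta>" using dist_triangle[of "?p k'" z w] by linarith
    then show "z \<in> (\<Union>k\<in>{1..n}. cball (?p k) (2 * \<eta>))" using k(3) by auto
  qed
  have "M0 (tube (closed_segment a b) \<eta>) \<le> M0 (\<Union>k\<in>{1..n}. cball (?p k) (2 * \<eta>))"
    by (intro measure_mono_fmeasurable sub) (auto intro!: lmeasurable_compact compact_tube
        fmeasurableD)
  also have "\<dots> \<le> (\<Sum>k\<in>{1..n}. M0 (cball (?p k) (2 * \<eta>)))"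
    by (intro measure_UNION_le) auto
  also have "\<dots> \<le> (\<Sum>k\<in>{1..n}. 4 * (2 * \<eta>)\<^sup>2)"
    by (intro sum_mono measure_cball_le) (use \<eta> in auto)
  also have "\<dots> = real n * (16 * \<eta>\<^sup>2)" by (simp add: power2_eq_square)
  also have "\<dots> \<le> (l / \<eta> + 2) * (16 * \<eta>\<^sup>2)" using n by (intro mult_right_mono) auto
  also have "\<dots> = 16 * l * \<eta> + 32 * \<eta>\<^sup>2" using \<eta> by (simp add: field_simps power2_eq_square)
  finally show ?thesis .
qed

lemma pathstart_polyline: "vs \<noteq> [] \<Longrightarrow> pathstart (polyline vs) = hd vs"
  by (induction vs rule: polyline.induct) auto

lemma pathfinish_polyline: "vs \<noteq> [] \<Longrightarrow> pathfinish (polyline vs) = last vs"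
  by (induction vs rule: polyline.induct) auto

lemma path_polyline: "path (polyline vs)"
proof (induction vs rule: polyline.induct)
  case (4 a b c vs)
  then show ?case by (simp add: pathstart_polyline)
qed (auto simp: path_def)

lemma set_subset_path_image_polyline: "set vs \<subseteq> path_image (polyline vs)"
proof (induction vs rule: polyline.induct)
  case (4 a b c vs)
  then show ?case by (auto simp: path_image_join pathstart_polyline)
qed auto

text \<open>
  There are at most \<open>length vs\<close> edges, a single vertex counting as a degenerate edge. The term \<open>+
  1\<close> is needed for the empty list, whose polygonal line is the constant \<open>0\<close>.
\<close>

lemma measure_tube_polyline_le:
  fixes l \<eta> :: real
  assumes "\<And>v w. v \<in> set vs \<Longrightarrow> w \<in> set vs \<Longrightarrow> norm (v - w) \<le> l" and \<eta>: "\<eta> > 0" and l: "l \<ge> 0"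
  shows "M0 (tube (path_image (polyline vs)) \<eta>) \<le> (length vs + 1) * (16 * l * \<eta> + 32 * \<eta>\<^sup>2)"
  using assms(1)
proof (induction vs rule: polyline.induct)
  case 1
  show ?case using measure_tube_segment_le[of 0 0 l \<eta>] \<eta> l by simp
next
  case (2 a)
  define E where "E = 16 * l * \<eta> + 32 * \<eta>\<^sup>2"
  have "0 \<le> E" "M0 (tube {a} \<eta>) \<le> E"
    using measure_tube_segment_le[of a a l \<eta>] \<eta> l by (simp_all add: E_def)
  then have "M0 (tube {a} \<eta>) \<le> 2 * E" by linarith
  then show ?case by (simp add: E_def)
next
  case (3 a b)
  define E where "E = 16 * l * \<eta> + 32 * \<eta>\<^sup>2"
  have "0 \<le> E" "M0 (tube (closed_segment a b) \<eta>) \<le> E"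
    using measure_tube_segment_le[of b a l \<eta>] \<eta> l 3[of b a] by (simp_all add: E_def)
  then have "M0 (tube (closed_segment a b) \<eta>) \<le> 3 * E" by linarith
  then show ?case by (simp add: E_def)
next
  case (4 a b c vs)
  let ?e = "16 * l * \<eta> + 32 * \<eta>\<^sup>2"
  let ?P = "path_image (polyline (b # c # vs))"
  have "path_image (polyline (a # b # c # vs)) = closed_segment a b \<union> ?P"
    by (simp add: path_image_join pathstart_polyline)
  then have "M0 (tube (path_image (polyline (a # b # c # vs))) \<eta>)
      \<le> M0 (tube (closed_segment a b) \<eta>) + M0 (tube ?P \<eta>)"
    by (simp only: tube_Un, intro measure_Un_le)
      (auto intro!: lmeasurable_compact compact_tube fmeasurableD compact_path_image path_polyline)
  also have "\<dots> \<le> ?e + (length (b # c # vs) + 1) * ?e"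
    using 4(2)[of b a] \<eta> by (intro add_mono measure_tube_segment_le 4(1)) (auto intro: 4(2))
  finally show ?case by (simp add: algebra_simps)
qed

lemma negligible_closed_segment_complex: "negligible (closed_segment a (b::complex))"
  using interior_closed_segment_ge2[of a b] by (simp add: negligible_convex_interior)

lemma negligible_path_image_polyline: "negligible (path_image (polyline vs))"
proof (induction vs rule: polyline.induct)
  case (4 a b c vs)
  then show ?case by (simp add: path_image_join pathstart_polyline
      negligible_closed_segment_complex)
qed (auto simp: negligible_closed_segment_complex)

lemma linepath_close:
  assumes "norm (a - a') \<le> \<eta>" "norm (b - b') \<le> \<eta>" "t \<in> {0..1}"
  shows "norm (linepath a b t - linepath a' b' t) \<le> \<eta>"
proof -
  have "linepath a b t - linepath a' b' t = (1 - t) *\<^sub>R (a - a') + t *\<^sub>R (b - b')"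
    by (simp add: linepath_def algebra_simps)
  also have "norm \<dots> \<le> (1 - t) * \<eta> + t * \<eta>"
    using assms by (intro norm_triangle_mono) (auto intro!: mult_left_mono)
  finally show ?thesis by (simp add: algebra_simps)
qed

lemma polyline_map_close:
  fixes \<eta> :: real and vs :: "complex list"
  assumes "\<And>v. v \<in> set vs \<Longrightarrow> norm (f v - g v) \<le> \<eta>" "\<eta> \<ge> 0" "t \<in> {0..1}"
  shows "norm (polyline (map f vs) t - polyline (map g vs) t) \<le> \<eta>"
  using assms
proof (induction vs arbitrary: t rule: polyline.induct)
  case (4 a b c vs)
  show ?case
  proof (cases "t \<le> 1/2")
    case True
    then show ?thesis using linepath_close[of "f a" "g a" \<eta> "f b" "g b" "2 * t"] 4(2-4)
      by (simp add: joinpaths_def)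
  next
    case False
    then show ?thesis using 4(1)[of "2 * t - 1"] 4(2-4) by (simp add: joinpaths_def)
  qed
qed (auto intro!: linepath_close)

text \<open>
  The polygonal line through the images of the vertices follows the image of the polygonal line
  with the same parametrization, so that edges can be compared one at a time. The comparison is
  required only for segments in a set \<open>S\<close> around the polygonal line, because \<open>f\<close> need not be
  controlled elsewhere.
\<close>

lemma polyline_map_image_close:
  fixes \<eta> :: real and vs :: "complex list"
  assumes "\<And>a b s. closed_segment a b \<subseteq> S \<Longrightarrow> a \<in> set vs \<Longrightarrow> b \<in> set vs \<Longrightarrow> s \<in> {0..1} \<Longrightarrow>
      norm (linepath (f a) (f b) s - f (linepath a b s)) \<le> \<eta>"
    and "path_image (polyline vs) \<subseteq> S" "vs \<noteq> []" "t \<in> {0..1}"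
  shows "norm (polyline (map f vs) t - f (polyline vs t)) \<le> \<eta>"
  using assms
proof (induction vs arbitrary: t rule: polyline.induct)
  case (4 a b c vs)
  have P: "closed_segment a b \<union> path_image (polyline (b # c # vs)) \<subseteq> S"
    using 4(3) by (simp add: path_image_join pathstart_polyline)
  show ?case
  proof (cases "t \<le> 1/2")
    case True
    then show ?thesis using P 4(2)[of a b "2 * t"] 4(5) by (simp add: joinpaths_def)
  next
    case False
    then show ?thesis using P 4(1)[of "2 * t - 1"] 4(2) 4(5) by (simp add: joinpaths_def)
  qed
next
  case (2 a)
  then show ?case using 2(1)[of a a t] by simp
next
  case (3 a b)
  then show ?case using 3(1)[of a b t] by simp
qed auto

section \<open>Area-preserving maps of the plane\<close>

text \<open>
  The change of variables formula is stated for \<open>real ^ 'n\<close>. It is transferred to the complex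
  plane along the isomorphism that reads real and imaginary parts as coordinates; \<open>complex_of_vec\<close>
  is its inverse.
\<close>

definition vec_of_complex :: "complex \<Rightarrow> real ^ 2" where
  "vec_of_complex z = vector [Re z, Im z]"

definition complex_of_vec :: "real ^ 2 \<Rightarrow> complex" where
  "complex_of_vec v = Complex (v $ 1) (v $ 2)"

lemma vec_of_complex_nth [simp]: "vec_of_complex z $ 1 = Re z" "vec_of_complex z $ 2 = Im z"
  by (simp_all add: vec_of_complex_def)

lemma complex_of_vec_inverse [simp]: "complex_of_vec (vec_of_complex z) = z"
  and vec_of_complex_inverse [simp]: "vec_of_complex (complex_of_vec v) = v"
  by (simp_all add: complex_of_vec_def vec_eq_iff forall_2)

lemma linear_vec_of_complex: "linear vec_of_complex"
  by (rule linearI) (simp_all add: vec_eq_iff forall_2)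

lemma linear_complex_of_vec: "linear complex_of_vec"
  by (rule linearI) (simp_all add: complex_of_vec_def complex_eq_iff)

lemma vec_of_complex_image: "vec_of_complex ` S = complex_of_vec -` S"
  by (auto simp: image_iff) (metis vec_of_complex_inverse)

lemma lborel_complex_eq_distr: "lborel = distr lborel borel complex_of_vec"
proof (rule lborel_eqI)
  fix l u :: complex assume le: "\<And>b. b \<in> Basis \<Longrightarrow> l \<bullet> b \<le> u \<bullet> b"
  have meas: "complex_of_vec \<in> borel_measurable borel"
    by (intro borel_measurable_continuous_onI linear_continuous_on linear_conv_bounded_linear[THEN
        iffD1] linear_complex_of_vec)
  have "complex_of_vec -` box l u = box (vec_of_complex l) (vec_of_complex u)"
    by (auto simp: in_box_complex_iff mem_box_cart forall_2 complex_of_vec_def)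
  then have "emeasure (distr lborel borel complex_of_vec) (box l u)
      = emeasure lborel (box (vec_of_complex l) (vec_of_complex u))"
    using meas by (subst emeasure_distr) auto
  also have "\<dots> = (\<Prod>b\<in>Basis. (vec_of_complex u - vec_of_complex l) \<bullet> b)"
  proof (rule emeasure_lborel_box)
    fix b :: "real ^ 2" assume "b \<in> Basis"
    then show "vec_of_complex l \<bullet> b \<le> vec_of_complex u \<bullet> b"
      using le[of 1] le[of \<i>] by (auto simp: Basis_vec_def inner_axis exhaust_2 Basis_complex_def
          UNIV_2)
  qed
  also have "(\<Prod>b\<in>Basis. (vec_of_complex u - vec_of_complex l) \<bullet> b) = (\<Prod>b\<in>Basis. (u - l) \<bullet> b)"
    by (simp add: Basis_vec_def UNIV_2 axis_eq_axis inner_axis Basis_complex_def complex_eq_iff)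
  finally show "emeasure (distr lborel borel complex_of_vec) (box l u) = (\<Prod>b\<in>Basis. (u - l) \<bullet> b)" .
qed simp

lemma lebesgue_vec_of_complex_image:
  assumes S: "S \<in> sets lebesgue"
  shows "vec_of_complex ` S \<in> sets lebesgue"
    and "emeasure lebesgue (vec_of_complex ` S) = emeasure lebesgue S"
proof -
  obtain C N where C: "fsigma C" and N: "N \<in> null_sets lebesgue" and SCN: "C \<union> N = S"
    by (rule lebesgue_set_almost_fsigma[OF S])
  have Cb: "C \<in> sets borel" using C by cases auto
  have meas: "complex_of_vec \<in> borel_measurable borel"
    by (intro borel_measurable_continuous_onI linear_continuous_on linear_conv_bounded_linear[THEN
        iffD1] linear_complex_of_vec)
  have vC: "vec_of_complex ` C \<in> sets borel"
    using measurable_sets[OF meas Cb] by (simp add: vec_of_complex_image)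
  have "emeasure lborel C = emeasure (distr lborel borel complex_of_vec) C"
    using lborel_complex_eq_distr by simp
  also have "\<dots> = emeasure lborel (vec_of_complex ` C)"
    using meas Cb by (subst emeasure_distr) (auto simp: vec_of_complex_image)
  finally have eC: "emeasure lebesgue (vec_of_complex ` C) = emeasure lebesgue C"
    using Cb vC by simp
  have "negligible (vec_of_complex ` N)"
    using N by (intro negligible_differentiable_image_negligible)
      (auto simp: negligible_iff_null_sets intro: linear_imp_differentiable_on
          linear_vec_of_complex)
  then have vN: "vec_of_complex ` N \<in> null_sets lebesgue" by (simp add: negligible_iff_null_sets)
  have un: "vec_of_complex ` S = vec_of_complex ` C \<union> vec_of_complex ` N" using SCN by auto
  show "vec_of_complex ` S \<in> sets lebesgue" unfolding un using vC vN by auto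
  show "emeasure lebesgue (vec_of_complex ` S) = emeasure lebesgue S"
  proof -
    have "emeasure lebesgue S = emeasure lebesgue C"
      using Cb N emeasure_Un_null_set[of C lebesgue N] by (simp add: SCN)
    then show ?thesis unfolding un using vC vN eC by (simp add: emeasure_Un_null_set)
  qed
qed

text \<open>
  The condition \<open>Im (cnj m1 * m2) = 1\<close> says that the Jacobian determinant, with columns \<open>m1\<close> and
  \<open>m2\<close>, is one.
\<close>

lemma measure_area_preserving_image:
  fixes f :: "complex \<Rightarrow> complex"
  assumes S: "S \<in> lmeasurable" and inj: "inj_on f S"
    and der: "\<And>x. x \<in> S \<Longrightarrow> \<exists>m1 m2. (f has_derivative (\<lambda>v. Re v *\<^sub>R m1 + Im v *\<^sub>R m2)) (at x)
      \<and> Im (cnj m1 * m2) = 1"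
  shows "f ` S \<in> lmeasurable" and "M0 (f ` S) = M0 S"
proof -
  obtain m1 m2 where m: "\<And>x. x \<in> S \<Longrightarrow> (f has_derivative (\<lambda>v. Re v *\<^sub>R m1 x + Im v *\<^sub>R m2 x)) (at x)"
    "\<And>x. x \<in> S \<Longrightarrow> Im (cnj (m1 x) * m2 x) = 1"
    using der by metis
  let ?S = "vec_of_complex ` S" and ?F = "vec_of_complex \<circ> f \<circ> complex_of_vec"
  define F' where "F' y = (\<lambda>v. vec_of_complex (Re (complex_of_vec v) *\<^sub>R m1 (complex_of_vec y)
      + Im (complex_of_vec v) *\<^sub>R m2 (complex_of_vec y)))" for y
  have Ssets: "S \<in> sets lebesgue" "emeasure lebesgue S < \<infinity>" using S by (auto simp: fmeasurable_def)
  have vS: "?S \<in> sets lebesgue" "?S \<in> lmeasurable"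
    using lebesgue_vec_of_complex_image[OF Ssets(1)] Ssets(2) by (auto simp: fmeasurable_def)
  have derF: "(?F has_derivative F' y) (at y within ?S)" if y: "y \<in> ?S" for y
  proof -
    obtain x where x: "x \<in> S" "y = vec_of_complex x" using y by auto
    have 1: "(complex_of_vec has_derivative complex_of_vec) (at y)"
      and 2: "(vec_of_complex has_derivative vec_of_complex) (at (f x))"
      by (simp_all add: linear_imp_has_derivative linear_complex_of_vec linear_vec_of_complex)
    have "(f \<circ> complex_of_vec has_derivative (\<lambda>v. Re v *\<^sub>R m1 x
        + Im v *\<^sub>R m2 x) \<circ> complex_of_vec) (at y)"
      by (rule diff_chain_at[OF 1]) (use m x in simp)
    then have "(vec_of_complex \<circ> (f \<circ> complex_of_vec) has_derivative
        vec_of_complex \<circ> ((\<lambda>v. Re v *\<^sub>R m1 x + Im v *\<^sub>R m2 x) \<circ> complex_of_vec)) (at y)"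
      by (rule diff_chain_at) (use 2 x in simp)
    then show ?thesis using x by (simp add: F'_def o_def has_derivative_at_withinI)
  qed
  have det: "\<bar>det (matrix (F' y))\<bar> = 1" if y: "y \<in> ?S" for y
  proof -
    obtain x where x: "x \<in> S" "y = vec_of_complex x" using y by auto
    have "det (matrix (F' y)) = Re (m1 x) * Im (m2 x) - Re (m2 x) * Im (m1 x)"
      by (simp add: det_2 matrix_def F'_def complex_of_vec_def axis_def x(2) del:
          complex_of_vec_inverse)
    also have "\<dots> = 1" using m(2)[OF x(1)] by (simp add: algebra_simps)
    finally show ?thesis by simp
  qed
  have injF: "inj_on ?F ?S"
  proof (rule inj_onI)
    fix x y assume "x \<in> ?S" "y \<in> ?S" and eq: "?F x = ?F y"
    then obtain a b where ab: "x = vec_of_complex a" "a \<in> S" "y = vec_of_complex b" "b \<in> S" by auto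
    have "vec_of_complex (f a) = vec_of_complex (f b)" using eq unfolding ab by simp
    then have "f a = f b" by (metis complex_of_vec_inverse)
    then show "x = y" using ab inj by (auto dest: inj_onD)
  qed
  have "((\<lambda>y. 1) has_integral measure lebesgue ?S) ?S"
    using vS(2) by (simp add: lmeasure_integral lmeasurable_iff_integrable_on integrable_integral)
  then have I: "((\<lambda>y. \<bar>det (matrix (F' y))\<bar>) has_integral measure lebesgue ?S) ?S"
    by (rule has_integral_eq[rotated]) (use det in simp)
  have FS: "?F ` ?S \<in> lmeasurable \<and> measure lebesgue (?F ` ?S) = measure lebesgue ?S"
    using has_measure_differentiable_image[OF vS(1) derF injF] I by blast
  have vfS: "vec_of_complex ` (f ` S) = ?F ` ?S" by (simp add: image_image)
  have fS: "f ` S \<in> sets lebesgue"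
    using Ssets m(1) by (intro differentiable_image_in_sets_lebesgue)
      (auto simp: differentiable_on_def differentiable_def intro: has_derivative_at_withinI)
  show "f ` S \<in> lmeasurable"
    using FS fS lebesgue_vec_of_complex_image(2)[OF fS] unfolding vfS fmeasurable_def by auto
  have "M0 (f ` S) = measure lebesgue (vec_of_complex ` (f ` S))"
    unfolding measure_def lebesgue_vec_of_complex_image(2)[OF fS] ..
  also have "\<dots> = measure lebesgue ?S" using FS unfolding vfS by blast
  also have "\<dots> = M0 S" unfolding measure_def lebesgue_vec_of_complex_image(2)[OF Ssets(1)] ..
  finally show "M0 (f ` S) = M0 S" .
qed

section \<open>Polygons and their images\<close>

lemma path_boundary_path: "path (boundary_path c)"
  and loop_boundary_path: "pathfinish (boundary_path c) = pathstart (boundary_path c)"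
proof -
  show "path (boundary_path c)" by (simp add: boundary_path_def path_polyline)
  show "pathfinish (boundary_path c) = pathstart (boundary_path c)"
    unfolding boundary_path_def by (cases c) (simp_all add: pathfinish_polyline pathstart_polyline)
qed

lemma compact_polygon: "compact (polygon c)"
  unfolding polygon_eq_enclosed_region
  by (rule compact_enclosed_region[OF path_boundary_path loop_boundary_path])

lemma set_subset_polygon: "set c \<subseteq> polygon c"
  using set_subset_path_image_polyline[of "c @ [hd c]"]
  by (auto simp: polygon_def boundary_path_def)

lemma boundary_path_map: "c \<noteq> [] \<Longrightarrow> boundary_path (map f c) = polyline (map f (c @ [hd c]))"
  by (simp add: boundary_path_def hd_map)

lemma simple_boundary_path_nonempty:
  assumes "simple_path (boundary_path c)"
  shows "c \<noteq> []"
proof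
  assume "c = []"
  then have "inj_on (\<lambda>t. hd [] :: complex) {0<..<(1::real)}"
    using simple_path_inj_on[OF assms] by (simp add: boundary_path_def linepath_refl)
  then show False by (auto dest!: inj_onD[of _ _ "1/2" "1/3"])
qed

lemma polygon_eq_boundary_Un_inside:
  "simple_path (boundary_path c) \<Longrightarrow> polygon c = path_image (boundary_path c)
      \<union> inside (path_image (boundary_path c))"
  by (simp add: polygon_eq_enclosed_region enclosed_region_simple loop_boundary_path)

text \<open>
  Two polygons with \<open>\<eta>\<close>-close vertices.
\<close>

lemma measure_sym_diff_polygon_le:
  fixes l \<eta> :: real and c :: "complex list"
  assumes c: "c \<noteq> []" and close: "\<And>v. v \<in> set c \<Longrightarrow> norm (f v - g v) \<le> \<eta>"
    and \<eta>: "\<eta> > 0" and l: "l \<ge> 0" "\<And>v w. v \<in> set c \<Longrightarrow> w \<in> set c \<Longrightarrow> norm (f v - f w) \<le> l"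
  shows "M0 (sym_diff (polygon (map g c)) (polygon (map f c)))
      \<le> (length c + 2) * (16 * l * \<eta> + 32 * \<eta>\<^sup>2)"
proof -
  let ?c = "c @ [hd c]"
  have set: "set ?c = set c" using c by auto
  have "sym_diff (polygon (map f c)) (polygon (map g c))
      \<subseteq> tube (path_image (boundary_path (map f c))) \<eta>"
    unfolding polygon_eq_enclosed_region
  proof (rule sym_diff_enclosed_region_subset_tube[OF path_boundary_path loop_boundary_path
      path_boundary_path loop_boundary_path])
    fix t :: real assume "t \<in> {0..1}"
    then show "norm (boundary_path (map f c) t - boundary_path (map g c) t) \<le> \<eta>"
      unfolding boundary_path_map[OF c]
      by (intro polyline_map_close) (use close set \<eta> in auto)
  qed
  then have "M0 (sym_diff (polygon (map g c)) (polygon (map f c)))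
      \<le> M0 (tube (path_image (polyline (map f ?c))) \<eta>)"
    unfolding boundary_path_map[OF c]
    by (intro measure_mono_fmeasurable)
      (auto intro!: lmeasurable_compact compact_tube compact_path_image path_polyline sets.Un
          sets.Diff
        fmeasurableD[OF lmeasurable_compact[OF compact_polygon]])
  also have "\<dots> \<le> (length (map f ?c) + 1) * (16 * l * \<eta> + 32 * \<eta>\<^sup>2)"
    using l set \<eta> by (intro measure_tube_polyline_le) auto
  finally show ?thesis by (simp add: add.commute)
qed

text \<open>
  The image of a polygon and the polygon through the images of its vertices, if each edge is
  mapped \<open>\<eta>\<close>-close to its chord.
\<close>

lemma measure_sym_diff_image_polygon_le:
  fixes l \<eta> :: real
  assumes c: "simple_path (boundary_path c)"
    and f: "continuous_on (polygon c) f" "inj_on f (polygon c)"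
    and close: "\<And>a b s. \<lbrakk>closed_segment a b \<subseteq> polygon c; a \<in> set c; b \<in> set c; s \<in> {0..1}\<rbrakk>
        \<Longrightarrow> norm (linepath (f a) (f b) s - f (linepath a b s)) \<le> \<eta>"
    and \<eta>: "\<eta> > 0" and l: "l \<ge> 0" "\<And>v w. v \<in> set c \<Longrightarrow> w \<in> set c \<Longrightarrow> norm (f v - f w) \<le> l"
  shows "M0 (sym_diff (polygon (map f c)) (f ` polygon c))
      \<le> (length c + 2) * (16 * l * \<eta> + 32 * \<eta>\<^sup>2)"
proof -
  let ?c = "c @ [hd c]"
  have ne: "c \<noteq> []" using c by (rule simple_boundary_path_nonempty)
  then have set: "set ?c = set c" by auto
  have img: "f ` polygon c = enclosed_region (f \<circ> boundary_path c)"
    using f unfolding polygon_eq_enclosed_region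
    by (intro image_enclosed_region c loop_boundary_path)
  have sub: "path_image (boundary_path c) \<subseteq> polygon c" by (auto simp: polygon_def)
  have p: "path (f \<circ> boundary_path c)"
    by (intro path_continuous_image path_boundary_path continuous_on_subset[OF f(1) sub])
  have lp: "pathfinish (f \<circ> boundary_path c) = pathstart (f \<circ> boundary_path c)"
    using loop_boundary_path[of c] by (simp add: pathfinish_def pathstart_def)
  have "sym_diff (polygon (map f c)) (f ` polygon c)
      \<subseteq> tube (path_image (boundary_path (map f c))) \<eta>"
    unfolding img unfolding polygon_eq_enclosed_region
  proof (rule sym_diff_enclosed_region_subset_tube[OF path_boundary_path loop_boundary_path p lp])
    fix t :: real assume t: "t \<in> {0..1}"
    show "norm (boundary_path (map f c) t - (f \<circ> boundary_path c) t) \<le> \<eta>"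
      unfolding boundary_path_map[OF ne] boundary_path_def[of c] o_def
    proof (rule polyline_map_image_close[where S = "polygon c"])
      fix a b and s :: real
      assume "closed_segment a b \<subseteq> polygon c" "a \<in> set ?c" "b \<in> set ?c" "s \<in> {0..1}"
      then show "norm (linepath (f a) (f b) s - f (linepath a b s)) \<le> \<eta>"
        using close unfolding set by blast
    qed (use t sub in \<open>simp_all add: boundary_path_def\<close>)
  qed
  then have "M0 (sym_diff (polygon (map f c)) (f ` polygon c))
      \<le> M0 (tube (path_image (polyline (map f ?c))) \<eta>)"
    unfolding boundary_path_map[OF ne]
    by (intro measure_mono_fmeasurable)
      (auto intro!: lmeasurable_compact compact_tube compact_path_image path_polyline sets.Un
          sets.Diff
        fmeasurableD[OF lmeasurable_compact[OF compact_polygon]]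
        fmeasurableD[OF lmeasurable_compact[OF compact_continuous_image[OF f(1) compact_polygon]]])
  also have "\<dots> \<le> (length (map f ?c) + 1) * (16 * l * \<eta> + 32 * \<eta>\<^sup>2)"
    using l set \<eta> by (intro measure_tube_polyline_le) auto
  finally show ?thesis by (simp add: add.commute)
qed

text \<open>
  With \<open>P1\<close>, \<open>P2\<close>, \<open>P3\<close> the approximate, polygonal and exact preimage and \<open>R\<close>, \<open>Q\<close> the approximate
  and exact liquid, this splits the error of the volume into the contributions of the
  reconstruction, of the polygonal representation and of the integration.
\<close>

lemma measure_Int_diff_le:
  assumes "P1 \<in> lmeasurable" "P2 \<in> lmeasurable" "P3 \<in> lmeasurable" "R \<in> lmeasurable"
      "Q \<in> lmeasurable"
  shows "\<bar>M0 (P1 \<inter> R) - M0 (P3 \<inter> Q)\<bar> \<le> M0 (sym_diff R Q) + M0 (sym_diff P2 P3)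
      + M0 (sym_diff P1 P2)"
proof -
  let ?E = "sym_diff R Q \<union> sym_diff P2 P3 \<union> sym_diff P1 P2"
  note m = assms
  have E: "?E \<in> lmeasurable" using m by (intro fmeasurable.Un fmeasurable.Diff)
  have EB: "M0 ?E \<le> M0 (sym_diff R Q) + M0 (sym_diff P2 P3) + M0 (sym_diff P1 P2)"
    using m by (intro order_trans[OF measure_Un_le] add_mono order_refl measure_Un_le)
      (auto intro!: fmeasurableD fmeasurable.Un fmeasurable.Diff)
  have PR: "P1 \<inter> R \<in> lmeasurable" and PQ: "P3 \<inter> Q \<in> lmeasurable" using m by auto
  have "M0 (P1 \<inter> R) \<le> M0 (P3 \<inter> Q \<union> ?E)"
    by (rule measure_mono_fmeasurable[OF _ fmeasurableD[OF PR] fmeasurable.Un[OF PQ E]]) blast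
  moreover have "M0 (P3 \<inter> Q) \<le> M0 (P1 \<inter> R \<union> ?E)"
    by (rule measure_mono_fmeasurable[OF _ fmeasurableD[OF PQ] fmeasurable.Un[OF PR E]]) blast
  moreover have "M0 (P3 \<inter> Q \<union> ?E) \<le> M0 (P3 \<inter> Q) + M0 ?E" "M0 (P1 \<inter> R \<union> ?E) \<le> M0 (P1 \<inter> R) + M0 ?E"
    using measure_Un_le[OF fmeasurableD[OF PQ] fmeasurableD[OF E]]
      measure_Un_le[OF fmeasurableD[OF PR] fmeasurableD[OF E]] by blast+
  ultimately show ?thesis using EB by linarith
qed

section \<open>Errors of a single control volume\<close>

text \<open>
  The area of a tube around edges of length at most \<open>2 * h\<close>, when its width \<open>\<eta>\<close> is at most a
  multiple of \<open>h\<close>.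
\<close>

lemma tube_bound_le:
  fixes h \<eta> A :: real and n N :: nat
  assumes "n \<le> N" "0 \<le> h" "0 \<le> \<eta>" "\<eta> \<le> A * h"
  shows "(n + 2) * (16 * (2 * h) * \<eta> + 32 * \<eta>\<^sup>2) \<le> 32 * (real N + 2) * (1 + A) * h * \<eta>"
proof -
  have "16 * (2 * h) * \<eta> + 32 * \<eta>\<^sup>2 = 32 * (h + \<eta>) * \<eta>"
      by (simp add: algebra_simps power2_eq_square)
  also have "\<dots> \<le> 32 * (h + A * h) * \<eta>" using assms by (intro mult_right_mono) auto
  finally have "16 * (2 * h) * \<eta> + 32 * \<eta>\<^sup>2 \<le> 32 * (1 + A) * h * \<eta>" by (simp add: algebra_simps)
  then have "(n + 2) * (16 * (2 * h) * \<eta> + 32 * \<eta>\<^sup>2) \<le> (real N + 2) * (32 * (1 + A) * h * \<eta>)"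
    using assms by (intro mult_mono) auto
  then show ?thesis by (simp add: algebra_simps)
qed

context short_time_flow
begin

lemma flow_inj_on:
  assumes "s \<in> {t0..t1}" "t \<in> {t0..t1}" "A \<subseteq> \<Omega>" "\<Psi> s t ` A \<subseteq> \<Omega>"
  shows "inj_on (\<Psi> s t) A"
  by (rule inj_on_inverseI[where g = "\<Psi> t s"]) (use flow_inverse assms in blast)

text \<open>
  Differentiability is known at interior points of \<open>\<Omega>\<close> only. The change of variables is therefore
  applied to the image of the inside of the cell, which is open; the boundary of the cell and its
  image, a Lipschitz image of a null set, do not contribute.
\<close>

lemma flow_preserves_liquid_volume:
  assumes c: "simple_path (boundary_path c)" "polygon c \<subseteq> \<Omega>"
    and st: "s \<in> {t0..t1}" "t \<in> {t0..t1}"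
    and P: "\<Psi> t s ` polygon c \<subseteq> \<Omega>" and L: "L \<subseteq> \<Omega>" "L \<in> sets lebesgue"
  shows "M0 (polygon c \<inter> \<Psi> s t ` L) = M0 (\<Psi> t s ` polygon c \<inter> L)"
proof -
  let ?f = "\<Psi> s t" and ?g = "\<Psi> t s" and ?b = "path_image (boundary_path c)"
  let ?I = "inside ?b"
  have poly: "polygon c = ?b \<union> ?I" by (rule polygon_eq_boundary_Un_inside[OF c(1)])
  have fg: "?f (?g y) = y" if "y \<in> polygon c" for y
    using flow_inverse[of t s y] st c(2) P that by blast
  have gf: "?g (?f x) = x" if "x \<in> L" "?f x \<in> polygon c" for x
    using flow_inverse[of s t x] st c(2) L that by blast
  have eq: "polygon c \<inter> ?f ` L = ?f ` (?g ` polygon c \<inter> L)"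
  proof (intro equalityI subsetI)
    fix y assume "y \<in> polygon c \<inter> ?f ` L"
    then obtain x where x: "y \<in> polygon c" "x \<in> L" "y = ?f x" by blast
    then have "x = ?g y" using gf[of x] by simp
    with x show "y \<in> ?f ` (?g ` polygon c \<inter> L)" by blast
  next
    fix y assume "y \<in> ?f ` (?g ` polygon c \<inter> L)"
    then obtain z where z: "z \<in> polygon c" "?g z \<in> L" "y = ?f (?g z)" by blast
    with fg[of z] show "y \<in> polygon c \<inter> ?f ` L" by force
  qed
  have gcont: "continuous_on (polygon c) ?g"
    using flow_continuous_on[OF st(2,1)] c(2) continuous_on_subset by blast
  have ginj: "inj_on ?g (polygon c)" using flow_inj_on[OF st(2,1) c(2) P] .
  have opn: "open (?g ` ?I)"
    using gcont ginj poly by (intro invariance_of_domain)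
      (auto intro: continuous_on_subset inj_on_subset open_inside closed_path_image
          path_boundary_path)
  define S where "S = ?g ` ?I \<inter> L"
  have bdd: "bounded (?g ` ?I)"
    using compact_imp_bounded[OF compact_continuous_image[OF gcont compact_polygon]] poly
    by (auto intro: bounded_subset)
  have S: "S \<in> lmeasurable"
    unfolding S_def using L by (intro fmeasurable_Int_fmeasurable lmeasurable_open bdd opn)
  have int: "x \<in> interior \<Omega>" if "x \<in> S" for x
    using interior_maximal[of "?g ` ?I" \<Omega>] opn P poly that by (auto simp: S_def)
  have injS: "inj_on ?f S"
    by (rule inj_on_inverseI[where g = ?g]) (use fg poly in \<open>auto simp: S_def\<close>)
  have vol: "?f ` S \<in> lmeasurable" "M0 (?f ` S) = M0 S"
    using measure_area_preserving_image[OF S injS] flow_differentiable[OF st int] by blast+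
  have negb: "negligible ?b" by (simp add: boundary_path_def negligible_path_image_polyline)
  have "negligible (?g ` ?b)"
  proof (rule negligible_locally_Lipschitz_image[OF _ negb])
    fix x assume x: "x \<in> ?b"
    have "norm (?g y - ?g x) \<le> 2 * norm (y - x)" if "y \<in> ?b \<inter> ball x (\<rho> / 6)" for y
      using that x poly c(2) by (intro flow_lipschitz[OF st(2,1)]) (auto simp: dist_norm
          norm_minus_commute)
    then show "\<exists>T B. open T \<and> x \<in> T \<and> (\<forall>y\<in>?b \<inter> T. norm (?g y - ?g x) \<le> B * norm (y - x))"
      using \<rho> by (intro exI[of _ "ball x (\<rho> / 6)"] exI[of _ 2]) auto
  qed simp
  then have "negligible ((S - ?g ` polygon c \<inter> L) \<union> (?g ` polygon c \<inter> L - S))"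
    by (rule negligible_subset) (auto simp: S_def poly)
  then have "M0 (?g ` polygon c \<inter> L) = M0 S"
    by (rule measure_negligible_symdiff[OF S])
  moreover have "M0 (?f ` (?g ` polygon c \<inter> L)) = M0 (?f ` S)"
  proof (rule measure_negligible_symdiff[OF vol(1)], rule negligible_subset[OF negb])
    have "?f ` S \<subseteq> ?f ` (?g ` polygon c \<inter> L)" by (intro image_mono) (auto simp: S_def poly)
    moreover have "y \<in> ?b" if y: "y \<in> ?f ` (?g ` polygon c \<inter> L)" "y \<notin> ?f ` S" for y
    proof -
      obtain z where z: "z \<in> polygon c" "?g z \<in> L" "y = ?f (?g z)" using y(1) by blast
      then have "z \<notin> ?I" using y(2) by (auto simp: S_def)
      then show ?thesis using z fg[OF z(1)] poly by simp
    qed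
    ultimately show "(?f ` S - ?f ` (?g ` polygon c \<inter> L)) \<union> (?f ` (?g ` polygon c \<inter> L) - ?f ` S)
        \<subseteq> ?b"
      by blast
  qed
  ultimately show ?thesis using vol(2) eq by simp
qed

lemma flow_edge_close_to_chord:
  assumes st: "s \<in> {t0..t1}" "t \<in> {t0..t1}"
      and ab: "closed_segment a b \<subseteq> \<Omega>" "norm (b - a) \<le> h" "h \<le> \<rho> / 6"
    and \<alpha>: "\<alpha> \<in> {0..1}"
  shows "norm (linepath (\<Psi> s t a) (\<Psi> s t b) \<alpha> - \<Psi> s t (linepath a b \<alpha>)) \<le> 8 * (t1 - t0) * B2 * h\<^sup>2"
proof -
  have l: "linepath a b \<alpha> = a + \<alpha> *\<^sub>R (b - a)" by (simp add: linepath_def algebra_simps)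
  have "linepath a b \<alpha> \<in> \<Omega>" using ab(1) \<alpha> linepath_in_path by blast
  moreover have "a \<in> \<Omega>" "b \<in> \<Omega>" using ab(1) by auto
  ultimately have "norm (\<Psi> s t (linepath a b \<alpha>) - linepath (\<Psi> s t a) (\<Psi> s t b) \<alpha>)
      \<le> 8 * (t1 - t0) * B2 * \<alpha> * (norm (b - a))\<^sup>2"
    using flow_almost_homogeneous[OF st, of a b \<alpha>] ab \<alpha> unfolding l by (simp add: linepath_def)
  also have "\<dots> \<le> 8 * (t1 - t0) * B2 * 1 * h\<^sup>2"
    using \<alpha> t01 B ab by (intro mult_mono power_mono) auto
  finally show ?thesis by (simp add: norm_minus_commute)
qed

text \<open>
  The pathline of the perturbed velocity stays near its end point because it moves with speed at
  most \<open>U + e\<close>.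
\<close>

lemma flow_vertex_error:
  assumes y: "pathline w D {t0..t1} y" "y t1 \<in> \<Omega>"
    and e: "\<And>t x. t \<in> {t0..t1} \<Longrightarrow> x \<in> D \<Longrightarrow> norm (w t x - u t x) \<le> e"
    and small: "(t1 - t0) * (U + e) \<le> \<rho>"
  shows "norm (\<Psi> t1 t0 (y t1) - y t0) \<le> 2 * (t1 - t0) * e"
proof -
  let ?v = "y t1"
  have st: "t1 \<in> {t0..t1}" "t0 \<in> {t0..t1}" using t01 by auto
  have yD: "y t \<in> D" if "t \<in> {t0..t1}" for t using y that by (simp add: pathline_def)
  have e0: "e \<ge> 0" using e[OF st(1) yD[OF st(1)]] norm_ge_zero order_trans by blast
  have "norm (\<Psi> t1 t0 ?v - y t0) \<le> 2 * norm (\<Psi> t1 t1 ?v - y t1) + 2 * (t1 - t0) * e"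
  proof (rule pathline_perturbation[OF flow_pathline(1)[OF st(1) y(2)] y(1) st y(2) _ _ e0 e])
    fix t assume t: "t \<in> {t0..t1}"
    show "\<Psi> t1 t ?v \<in> cball ?v \<rho>"
      using pathline_near[OF flow_pathline(1)[OF st(1) y(2)] st(1) t, of ?v] flow_pathline(2)[OF
          st(1) y(2)] \<rho>
      by (simp add: dist_norm norm_minus_commute)
    have "norm (y t - y t1) \<le> (t1 - t0) * (U + e)"
    proof (rule displacement_bound[OF st(1) t])
      fix t assume t: "t \<in> {t0..t1}"
      show "(y has_vector_derivative w t (y t)) (at t within {t0..t1})" using y t
          by (simp add: pathline_def)
      show "norm (w t (y t)) \<le> U + e"
        using norm_triangle_sub[of "w t (y t)" "u t (y t)"] speed[OF t yD[OF t]] e[OF t yD[OF t]]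
            by linarith
    qed
    then show "y t \<in> cball ?v \<rho>" using small by (simp add: dist_norm norm_minus_commute)
  qed auto
  then show ?thesis using flow_pathline(2)[OF st(1) y(2)] by simp
qed

lemma cell_representation_error:
  fixes h \<eta> A :: real
  assumes c: "simple_path (boundary_path c)" "polygon c \<subseteq> \<Omega>" "\<Psi> t1 t0 ` polygon c \<subseteq> \<Omega>"
      "length c \<le> N"
    and h: "\<And>v w. v \<in> polygon c \<Longrightarrow> w \<in> polygon c \<Longrightarrow> norm (v - w) \<le> h" "h \<le> \<rho> / 6" "0 < h"
    and \<eta>: "8 * (t1 - t0) * B2 * h\<^sup>2 \<le> \<eta>" "0 < \<eta>" "\<eta> \<le> A * h"
  shows "M0 (sym_diff (polygon (map (\<Psi> t1 t0) c)) (\<Psi> t1 t0 ` polygon c))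
      \<le> 32 * (real N + 2) * (1 + A) * h * \<eta>"
proof -
  have st: "t1 \<in> {t0..t1}" "t0 \<in> {t0..t1}" using t01 by auto
  have V: "v \<in> polygon c" "v \<in> \<Omega>" if "v \<in> set c" for v using set_subset_polygon c that by auto
  have "M0 (sym_diff (polygon (map (\<Psi> t1 t0) c)) (\<Psi> t1 t0 ` polygon c))
      \<le> (length c + 2) * (16 * (2 * h) * \<eta> + 32 * \<eta>\<^sup>2)"
  proof (rule measure_sym_diff_image_polygon_le[OF c(1)])
    show "continuous_on (polygon c) (\<Psi> t1 t0)"
      using flow_continuous_on[OF st] c(2) continuous_on_subset by blast
    show "inj_on (\<Psi> t1 t0) (polygon c)" using flow_inj_on[OF st c(2,3)] .
    fix a b and \<alpha> :: real assume "closed_segment a b \<subseteq> polygon c" "a \<in> set c" "b \<in> set c"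
        "\<alpha> \<in> {0..1}"
    then show "norm (linepath (\<Psi> t1 t0 a) (\<Psi> t1 t0 b) \<alpha> - \<Psi> t1 t0 (linepath a b \<alpha>)) \<le> \<eta>"
      using flow_edge_close_to_chord[OF st, of a b h \<alpha>] c(2) h V \<eta>(1) by force
  next
    fix v w assume vw: "v \<in> set c" "w \<in> set c"
    then have "norm (v - w) \<le> h" using h(1) V by blast
    then show "norm (\<Psi> t1 t0 v - \<Psi> t1 t0 w) \<le> 2 * h"
      using flow_lipschitz[OF st V(2)[OF vw(1)] V(2)[OF vw(2)]] h(2) by linarith
  qed (use h \<eta> in auto)
  also have "\<dots> \<le> 32 * (real N + 2) * (1 + A) * h * \<eta>"
    using c h \<eta> by (intro tube_bound_le) auto
  finally show ?thesis .
qed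

lemma cell_integration_error:
  fixes h \<eta> A :: real
  assumes c: "simple_path (boundary_path c)" "polygon c \<subseteq> \<Omega>" "length c \<le> N"
    and h: "\<And>v w. v \<in> polygon c \<Longrightarrow> w \<in> polygon c \<Longrightarrow> norm (v - w) \<le> h" "h \<le> \<rho> / 6" "0 < h"
    and \<eta>: "\<And>v. v \<in> set c \<Longrightarrow> norm (\<Psi> t1 t0 v - g v) \<le> \<eta>" "0 < \<eta>" "\<eta> \<le> A * h"
  shows "M0 (sym_diff (polygon (map g c)) (polygon (map (\<Psi> t1 t0) c)))
      \<le> 32 * (real N + 2) * (1 + A) * h * \<eta>"
proof -
  have st: "t1 \<in> {t0..t1}" "t0 \<in> {t0..t1}" using t01 by auto
  have V: "v \<in> polygon c" "v \<in> \<Omega>" if "v \<in> set c" for v using set_subset_polygon c that by auto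
  have "M0 (sym_diff (polygon (map g c)) (polygon (map (\<Psi> t1 t0) c)))
      \<le> (length c + 2) * (16 * (2 * h) * \<eta> + 32 * \<eta>\<^sup>2)"
  proof (rule measure_sym_diff_polygon_le[OF simple_boundary_path_nonempty[OF c(1)] \<eta>(1)])
    fix v w assume vw: "v \<in> set c" "w \<in> set c"
    then have "norm (v - w) \<le> h" using h(1) V by blast
    then show "norm (\<Psi> t1 t0 v - \<Psi> t1 t0 w) \<le> 2 * h"
      using flow_lipschitz[OF st V(2)[OF vw(1)] V(2)[OF vw(2)]] h(2) by linarith
  qed (use h \<eta> in auto)
  also have "\<dots> \<le> 32 * (real N + 2) * (1 + A) * h * \<eta>"
    using c h \<eta> by (intro tube_bound_le) auto
  finally show ?thesis .
qed

end

section \<open>Maximum norms over the mesh and sums of Landau classes\<close>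

lemma mesh_cell_facts:
  assumes m: "is_mesh \<Omega> C" and c: "c \<in> C"
  shows "simple_path (boundary_path c)" "polygon c \<subseteq> \<Omega>" "neighbourhood C c \<subseteq> \<Omega>"
    "compact (neighbourhood C c)"
    "\<And>v w. v \<in> polygon c \<Longrightarrow> w \<in> polygon c \<Longrightarrow> norm (v - w) \<le> mesh_size C"
proof -
  have fin: "finite C" using m by (simp add: is_mesh_def)
  show "simple_path (boundary_path c)" "polygon c \<subseteq> \<Omega>" "neighbourhood C c \<subseteq> \<Omega>"
    using m c by (auto simp: is_mesh_def neighbourhood_def neighbours_def)
  show "compact (neighbourhood C c)"
    unfolding neighbourhood_def neighbours_def using fin by (intro compact_UN compact_polygon) auto
  fix v w assume "v \<in> polygon c" "w \<in> polygon c"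
  then have "norm (v - w) \<le> diameter (polygon c)"
    using diameter_bounded_bound[OF compact_imp_bounded[OF compact_polygon]]
        by (simp add: dist_norm)
  also have "\<dots> \<le> mesh_size C" unfolding mesh_size_def using fin c by (intro Max_ge) auto
  finally show "norm (v - w) \<le> mesh_size C" .
qed

lemma linf_norm_le:
  assumes "finite C" "C \<noteq> {}" "\<And>c. c \<in> C \<Longrightarrow> \<bar>f c\<bar> \<le> b"
  shows "linf_norm C f \<le> b"
  using assms by (simp add: linf_norm_def)

lemma linf_norm_ge: "finite C \<Longrightarrow> c \<in> C \<Longrightarrow> \<bar>f c\<bar> \<le> linf_norm C f"
  by (simp add: linf_norm_def)

lemma linf_norm_nonneg: "finite C \<Longrightarrow> C \<noteq> {} \<Longrightarrow> 0 \<le> linf_norm C f"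
  using linf_norm_ge abs_ge_zero order_trans by (metis ex_in_conv)

text \<open>
  The function \<open>f\<close> is divided in proportion to \<open>f1\<close>, \<open>f2\<close> and \<open>f3\<close>. The third part is defined as
  the remainder, because the parts have to add up to \<open>f\<close> also where the estimate fails or the sum
  of the bounds vanishes.
\<close>

lemma bigo_sum_decomposition:
  fixes f f1 f2 f3 :: "'i \<Rightarrow> real"
  assumes le: "\<forall>\<^sub>F i in F. \<bar>f i\<bar> \<le> f1 i + f2 i + f3 i"
    and nn: "\<And>i. f1 i \<ge> 0" "\<And>i. f2 i \<ge> 0" "\<And>i. f3 i \<ge> 0"
    and O: "f1 \<in> O[F](g1)" "f2 \<in> O[F](g2)" "f3 \<in> O[F](g3)"
  shows "f \<in> O[F](g1) + O[F](g2) + O[F](g3)"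
proof -
  let ?s = "\<lambda>i. f1 i + f2 i + f3 i"
  define a1 where "a1 i = f i * (f1 i / ?s i)" for i
  define a2 where "a2 i = f i * (f2 i / ?s i)" for i
  define a3 where "a3 i = f i - a1 i - a2 i" for i
  have E: "\<forall>\<^sub>F i in F. \<bar>a1 i\<bar> \<le> f1 i \<and> \<bar>a2 i\<bar> \<le> f2 i \<and> \<bar>a3 i\<bar> \<le> f3 i"
    using le
  proof eventually_elim
    case (elim i)
    show ?case
    proof (cases "?s i = 0")
      case True
      then have "f1 i = 0" "f2 i = 0" "f3 i = 0" "f i = 0" using nn[of i] elim by linarith+
      then show ?thesis by (simp add: a1_def a2_def a3_def)
    next
      case False
      then have s: "?s i > 0" using nn[of i] by linarith
      have *: "\<bar>f i * (x / ?s i)\<bar> \<le> x" if "x \<ge> 0" for x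
      proof -
        have "\<bar>f i * (x / ?s i)\<bar> = \<bar>f i\<bar> * x / ?s i" using s that by (simp add: abs_mult)
        also have "\<dots> \<le> ?s i * x / ?s i" using elim s that
            by (intro divide_right_mono mult_right_mono) auto
        finally show ?thesis using s by simp
      qed
      have "f1 i / ?s i + f2 i / ?s i + f3 i / ?s i = 1" using s by (simp flip: add_divide_distrib)
      then have "f i = f i * (f1 i / ?s i + f2 i / ?s i + f3 i / ?s i)" by simp
      then have "a3 i = f i * (f3 i / ?s i)" by (simp only: a1_def a2_def a3_def distrib_left)
      then show ?thesis using *[of "f1 i"] *[of "f2 i"] *[of "f3 i"] nn by (simp add: a1_def a2_def)
    qed
  qed
  have "a1 \<in> O[F](f1)" "a2 \<in> O[F](f2)" "a3 \<in> O[F](f3)"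
    by (rule bigoI[of _ 1], use E nn in \<open>auto elim!: eventually_mono\<close>)+
  then have "a1 \<in> O[F](g1)" "a2 \<in> O[F](g2)" "a3 \<in> O[F](g3)"
    using O landau_o.big_trans by blast+
  moreover have "f = a1 + a2 + a3" by (auto simp: a3_def)
  ultimately show ?thesis by (auto intro: set_plus_intro)
qed

section \<open>Accuracy of the volume fractions\<close>

theorem theorem1:
  fixes F :: "'i filter"
    and \<Omega> D :: "complex set"
    and u :: velocity
    and \<Psi> :: "real \<Rightarrow> real \<Rightarrow> complex \<Rightarrow> complex"
    and \<Phi> :: integrator
    and T U C0 r :: real
    and N q :: nat
    and mesh :: "'i \<Rightarrow> complex list set"
    and h \<delta> tn :: "'i \<Rightarrow> real"
    and uInt :: "'i \<Rightarrow> velocity"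
    and L :: "'i \<Rightarrow> complex set"
    and R :: "'i \<Rightarrow> complex list \<Rightarrow> complex set"
  assumes mesh: "\<And>i. is_mesh \<Omega> (mesh i)"
    and h: "\<And>i. h i = mesh_size (mesh i)"
    and h_tendsto: "(h \<longlongrightarrow> 0) F"
    and edges: "\<And>i c. c \<in> mesh i \<Longrightarrow> length c \<le> N"
    and quasi_uniform: "C0 > 0" "\<And>i c. c \<in> mesh i \<Longrightarrow> M0 (polygon c) \<ge> C0 * (h i)\<^sup>2"
    and domain: "open D" "\<Omega> \<subseteq> D"
    and velocity_smooth: "smooth_velocity {0..T} D u"
    and velocity_divergence_free: "\<And>t x. t \<in> {0..T} \<Longrightarrow> x \<in> D \<Longrightarrow> divergence (u t) x = 0"
    and velocity_scale: "U > 0" "\<And>t x. t \<in> {0..T} \<Longrightarrow> x \<in> D \<Longrightarrow> norm (u t x) \<le> U"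
    and time_step: "\<And>i. \<delta> i > 0" "\<And>i. 0 \<le> tn i" "\<And>i. tn i + \<delta> i \<le> T"
    and CFL: "\<And>i. \<delta> i \<le> h i / U"
    and proportional: "\<delta> \<in> \<Theta>[F](h)"
    and flow: "\<And>i. is_flow u D {tn i..tn i + \<delta> i} \<Omega> \<Psi>"
    and liquid: "\<And>i. L i \<subseteq> \<Omega>" "\<And>i. L i \<in> sets lebesgue"
    and preimage_nbhd:
      "\<And>i c. c \<in> mesh i \<Longrightarrow> preimage \<Psi> (tn i) (\<delta> i) c \<subseteq> neighbourhood (mesh i) c"
      "\<And>i c. c \<in> mesh i \<Longrightarrow>
        approx_preimage \<Phi> (uInt i) (tn i) (\<delta> i) c \<subseteq> neighbourhood (mesh i) c"
    and reconstruction: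
      "\<And>i c. c \<in> mesh i \<Longrightarrow> R i c \<subseteq> neighbourhood (mesh i) c"
      "\<And>i c. c \<in> mesh i \<Longrightarrow> R i c \<in> sets lebesgue"
    and reconstruction_order:
      "(\<lambda>i. linf_norm (mesh i) (rec_error (mesh i) (L i) (R i))) \<in> O[F](\<lambda>i. h i powr r)"
    and interpolation:
      "\<exists>K. \<forall>\<^sub>F i in F. \<forall>t\<in>{tn i..tn i + \<delta> i}. \<forall>x\<in>D.
        norm (uInt i t x - u t x) \<le> K * (h i + \<delta> i)\<^sup>2"
    and integration_order:
      "\<exists>K. \<forall>\<^sub>F i in F. \<forall>c\<in>mesh i. \<forall>v\<in>set c.
        \<exists>y. pathline (uInt i) D {tn i..tn i + \<delta> i} y \<and> y (tn i + \<delta> i) = v \<and>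
          norm (\<Phi> (uInt i) (tn i + \<delta> i) (- \<delta> i) v - y (tn i)) \<le> K * \<delta> i ^ (q + 1)"
  defines "err \<equiv> \<lambda>i. linf_norm (mesh i) (\<lambda>c.
      approx_fraction \<Phi> (uInt i) (tn i) (\<delta> i) (R i) c - exact_fraction \<Psi> (tn i) (\<delta> i) (L i) c)"
    and "errRec \<equiv> \<lambda>i. linf_norm (mesh i) (\<lambda>c.
      rec_error (mesh i) (L i) (R i) c / M0 (polygon c))"
    and "errRep \<equiv> \<lambda>i. linf_norm (mesh i) (\<lambda>c.
      rep_error \<Psi> (tn i) (\<delta> i) c / M0 (polygon c))"
    and "errInt \<equiv> \<lambda>i. linf_norm (mesh i) (\<lambda>c.
      int_error \<Psi> \<Phi> (uInt i) (tn i) (\<delta> i) c / M0 (polygon c))"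
  shows "err \<in> O[F](\<lambda>i. h i powr (r - 2)) + O[F](\<lambda>i. (h i)\<^sup>2) + O[F](\<lambda>i. (h i)\<^sup>2 + h i ^ q)
    \<and> (\<forall>\<^sub>F i in F. err i \<le> errRec i + errRep i + errInt i)
    \<and> errRec \<in> O[F](\<lambda>i. h i powr (r - 2))
    \<and> errRep \<in> O[F](\<lambda>i. (h i)\<^sup>2)
    \<and> errInt \<in> O[F](\<lambda>i. (h i)\<^sup>2 + h i ^ q)"
proof -
  have fin: "finite (mesh i)" "mesh i \<noteq> {}" for i using mesh[of i] by (auto simp: is_mesh_def)
  have \<Omega>eq: "\<Omega> = (\<Union>c\<in>mesh i. polygon c)" for i using mesh[of i] by (auto simp: is_mesh_def)
  have \<Omega>comp: "compact \<Omega>"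
    unfolding \<Omega>eq[of undefined] by (intro compact_UN fin compact_polygon)
  obtain \<rho> B1 B2 u' where \<rho>: "\<rho> > 0" and B: "B1 \<ge> 0" "B2 \<ge> 0"
    and der: "\<And>t x. t \<in> {0..T} \<Longrightarrow> x \<in> D \<Longrightarrow> (u t has_derivative blinfun_apply (u' t x)) (at x)"
    and lip: "\<And>a t x y. \<lbrakk>a \<in> \<Omega>; t \<in> {0..T}; x \<in> cball a \<rho>; y \<in> cball a \<rho>\<rbrakk>
        \<Longrightarrow> norm (u t x - u t y) \<le> B1 * norm (x - y)"
    and taylor: "\<And>a t x y. \<lbrakk>a \<in> \<Omega>; t \<in> {0..T}; x \<in> cball a \<rho>; y \<in> cball a \<rho>\<rbrakk>
        \<Longrightarrow> norm (u t x - u t y - blinfun_apply (u' t y) (x - y)) \<le> B2 * (norm (x - y))\<^sup>2"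
    by (rule smooth_velocity_local_bounds[OF velocity_smooth domain \<Omega>comp]) (rule that; assumption)
  have trace: "Re (blinfun_apply (u' t x) 1) + Im (blinfun_apply (u' t x) \<i>) = 0"
      if "t \<in> {0..T}" "x \<in> D" for t x
    using velocity_divergence_free[OF that] frechet_derivative_at[OF der[OF that], symmetric]
    by (simp add: divergence_def Basis_complex_def)
  obtain K1 where K1: "\<forall>\<^sub>F i in F. \<forall>t\<in>{tn i..tn i + \<delta> i}. \<forall>x\<in>D. norm (uInt i t x - u t x)
      \<le> K1 * (h i + \<delta> i)\<^sup>2"
    using interpolation by blast
  obtain K2 where K2: "\<forall>\<^sub>F i in F. \<forall>c\<in>mesh i. \<forall>v\<in>set c.
        \<exists>y. pathline (uInt i) D {tn i..tn i + \<delta> i} y \<and> y (tn i + \<delta> i) = v \<and>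
          norm (\<Phi> (uInt i) (tn i + \<delta> i) (- \<delta> i) v - y (tn i)) \<le> K2 * \<delta> i ^ (q + 1)"
    using integration_order by blast
  \<comment> \<open>\<open>E1 * h\<^sup>2\<close> bounds the interpolation error and \<open>E2 * h ^ (q + 1)\<close> the one-step error, by \<open>\<delta> \<le> h / U\<close>;
    \<open>A1 * h ^ 3\<close> and \<open>A2 * h * (h\<^sup>2 + h ^ q)\<close> bound the resulting distances of the boundary curves. The
    summands \<open>1\<close> keep these widths positive.\<close>
  define E1 where "E1 = \<bar>K1\<bar> * (1 + 1 / U)\<^sup>2"
  define E2 where "E2 = \<bar>K2\<bar> / U ^ (q + 1)"
  define A1 where "A1 = 8 * B2 / U + 1"
  define A2 where "A2 = 2 * E1 / U + E2 + 1"
  define Crep where "Crep = 32 * (real N + 2) * (1 + A1) * A1"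
  define Cint where "Cint = 32 * (real N + 2) * (1 + 2 * A2) * A2"
  have U: "U > 0" by (rule velocity_scale(1))
  have nn: "E1 \<ge> 0" "E2 \<ge> 0" "A1 \<ge> 1" "A2 \<ge> 1" "Crep \<ge> 0" "Cint \<ge> 0"
    using U B by (auto simp: E1_def E2_def A1_def A2_def Crep_def Cint_def)
  have hpos: "h i > 0" for i
    using order_less_le_trans[OF time_step(1)[of i] CFL[of i]] U by (simp add: zero_less_divide_iff)
  have \<delta>h: "\<delta> i * U \<le> h i" for i using CFL[of i] U by (simp add: pos_le_divide_eq)
  have Mpos: "M0 (polygon c) \<ge> C0 * (h i)\<^sup>2" "C0 * (h i)\<^sup>2 > 0" "M0 (polygon c) > 0"
      if "c \<in> mesh i" for i c
    using quasi_uniform(2)[OF that] quasi_uniform(1) hpos[of i]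
    by (auto intro: less_le_trans[of 0 "C0 * (h i)\<^sup>2"])
  \<comment> \<open>The indices at which the mesh is fine enough and the eventual bounds hold.\<close>
  define good where "good i \<longleftrightarrow> h i < 1 \<and> h i \<le> \<rho> / 6 \<and> h i * B1 \<le> U / 2 \<and> h i * (U + 1) \<le> \<rho> * U
      \<and> E1 * h i \<le> 1
      \<and> (\<forall>t\<in>{tn i..tn i + \<delta> i}. \<forall>x\<in>D. norm (uInt i t x - u t x) \<le> K1 * (h i + \<delta> i)\<^sup>2)
      \<and> (\<forall>c\<in>mesh i. \<forall>v\<in>set c.
        \<exists>y. pathline (uInt i) D {tn i..tn i + \<delta> i} y \<and> y (tn i + \<delta> i) = v \<and>
          norm (\<Phi> (uInt i) (tn i + \<delta> i) (- \<delta> i) v - y (tn i)) \<le> K2 * \<delta> i ^ (q + 1))" for i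
  have small: "\<forall>\<^sub>F i in F. h i * a < b" if "b > 0" for a b :: real
  proof -
    have "((\<lambda>i. h i * a) \<longlongrightarrow> 0 * a) F" by (intro tendsto_intros h_tendsto)
    then show ?thesis using that by (intro order_tendstoD) auto
  qed
  have good: "eventually good F"
  proof -
    have "\<forall>\<^sub>F i in F. h i * 1 < 1" "\<forall>\<^sub>F i in F. h i * 1 < \<rho> / 6" "\<forall>\<^sub>F i in F. h i * B1 < U / 2"
      "\<forall>\<^sub>F i in F. h i * (U + 1) < \<rho> * U" "\<forall>\<^sub>F i in F. h i * E1 < 1"
      by (rule small, use \<rho> U in simp)+
    then show ?thesis
      using K1 K2 by eventually_elim (simp add: good_def mult.commute[of E1])
  qed
  have cell: "rep_error \<Psi> (tn i) (\<delta> i) c \<le> Crep * h i ^ 4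
      \<and> int_error \<Psi> \<Phi> (uInt i) (tn i) (\<delta> i) c \<le> Cint * (h i)\<^sup>2 * ((h i)\<^sup>2 + h i ^ q)
      \<and> \<bar>approx_fraction \<Phi> (uInt i) (tn i) (\<delta> i) (R i) c - exact_fraction \<Psi> (tn i) (\<delta> i) (L i) c\<bar>
        \<le> (rec_error (mesh i) (L i) (R i) c + rep_error \<Psi> (tn i) (\<delta> i) c
          + int_error \<Psi> \<Phi> (uInt i) (tn i) (\<delta> i) c) / M0 (polygon c)"
    if g: "good i" and c: "c \<in> mesh i" for i c
  proof -
    let ?t0 = "tn i" and ?t1 = "tn i + \<delta> i"
    have J: "t \<in> {0..T}" if "t \<in> {?t0..?t1}" for t using that time_step(2,3)[of i] by auto
    have dpos: "\<delta> i > 0" by (rule time_step)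
    have g1: "h i < 1" "h i \<le> \<rho> / 6" "h i * B1 \<le> U / 2" "h i * (U + 1) \<le> \<rho> * U" "E1 * h i \<le> 1"
      and g2: "\<And>t x. t \<in> {?t0..?t1} \<Longrightarrow> x \<in> D \<Longrightarrow> norm (uInt i t x - u t x) \<le> K1 * (h i + \<delta> i)\<^sup>2"
      and g3: "\<And>v. v \<in> set c \<Longrightarrow> \<exists>y. pathline (uInt i) D {?t0..?t1} y \<and> y ?t1 = v \<and>
          norm (\<Phi> (uInt i) ?t1 (- \<delta> i) v - y ?t0) \<le> K2 * \<delta> i ^ (q + 1)"
      using g c unfolding good_def by blast+
    interpret short_time_flow u D \<Omega> ?t0 ?t1 \<rho> B1 B2 U u' \<Psi>
    proof
      show "(?t1 - ?t0) * B1 \<le> 1 / 2"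
      proof -
        have "U * (\<delta> i * B1) \<le> h i * B1" using mult_right_mono[OF \<delta>h[of i] B(1)]
            by (simp add: mult_ac)
        then have "U * (\<delta> i * B1) \<le> U * (1 / 2)" using g1(3) by simp
        then show ?thesis using U by (simp only: mult_le_cancel_left_pos) simp
      qed
      show "(?t1 - ?t0) * U \<le> \<rho> / 6" using \<delta>h[of i] g1(2) by simp
    qed (use dpos \<rho> B J lip taylor trace velocity_scale flow in \<open>auto\<close>)
    note mf = mesh_cell_facts[OF mesh c]
    have c_simple: "simple_path (boundary_path c)" and c_sub: "polygon c \<subseteq> \<Omega>" by (fact mf)+
    have diam: "norm (v - w) \<le> h i" if "v \<in> polygon c" "w \<in> polygon c" for v w
      using mf(5)[OF that] by (simp add: h)
    let ?P = "\<Psi> ?t1 ?t0 ` polygon c"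
    have P: "?P \<subseteq> neighbourhood (mesh i) c" "?P \<subseteq> \<Omega>"
      using preimage_nbhd(1)[OF c] mf(3) by (auto simp: preimage_def)
    have d_le: "\<delta> i \<le> h i / U" by (rule CFL)
    have rep: "rep_error \<Psi> (tn i) (\<delta> i) c \<le> Crep * h i ^ 4"
    proof -
      have "8 * \<delta> i * B2 * (h i)\<^sup>2 \<le> 8 * (h i / U) * B2 * (h i)\<^sup>2"
        using d_le B by (intro mult_right_mono mult_left_mono) auto
      also have "\<dots> \<le> A1 * h i ^ 3"
        using hpos[of i] by (simp add: A1_def power2_eq_square power3_eq_cube algebra_simps)
      finally have 1: "8 * (?t1 - ?t0) * B2 * (h i)\<^sup>2 \<le> A1 * h i ^ 3" by simp
      have "h i ^ 3 \<le> h i" using power_decreasing[of 1 3 "h i"] hpos[of i] g1 by simp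
      then have 2: "A1 * h i ^ 3 \<le> A1 * h i" using nn by (intro mult_left_mono) auto
      have "rep_error \<Psi> (tn i) (\<delta> i) c \<le> 32 * (real N + 2) * (1 + A1) * h i * (A1 * h i ^ 3)"
        unfolding rep_error_def rep_preimage_def preimage_def
        by (rule cell_representation_error[OF c_simple c_sub P(2) edges[OF c] diam g1(2) hpos 1 _
            2])
          (use nn hpos[of i] in auto)
      also have "\<dots> = Crep * h i ^ 4" by (simp add: Crep_def power_numeral_reduce)
      finally show ?thesis .
    qed
    let ?H = "(h i)\<^sup>2 + h i ^ q"
    have int: "int_error \<Psi> \<Phi> (uInt i) (tn i) (\<delta> i) c \<le> Cint * (h i)\<^sup>2 * ?H"
    proof -
      define e where "e = E1 * (h i)\<^sup>2"
      have e: "norm (uInt i t x - u t x) \<le> e" if "t \<in> {?t0..?t1}" "x \<in> D" for t x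
      proof -
        have "norm (uInt i t x - u t x) \<le> \<bar>K1\<bar> * (h i + \<delta> i)\<^sup>2"
          using g2[OF that] mult_right_mono[OF abs_ge_self[of K1], of "(h i + \<delta> i)\<^sup>2"] by simp
        also have "\<dots> \<le> \<bar>K1\<bar> * (h i + h i / U)\<^sup>2"
          using d_le hpos[of i] dpos by (intro mult_left_mono power_mono) auto
        also have "h i + h i / U = (1 + 1 / U) * h i" by (simp add: algebra_simps)
        also have "\<bar>K1\<bar> * ((1 + 1 / U) * h i)\<^sup>2 = e" by (simp add: e_def E1_def power_mult_distrib)
        finally show ?thesis .
      qed
      have "e \<le> E1 * h i" unfolding e_def using nn hpos[of i] g1
        by (intro mult_left_mono) (auto simp: power2_eq_square mult_left_le)
      then have e1: "0 \<le> e" "e \<le> 1" using g1 nn by (auto simp: e_def)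
      have small\<rho>: "(?t1 - ?t0) * (U + e) \<le> \<rho>"
      proof -
        have "\<delta> i * (U + e) \<le> (h i / U) * (U + 1)"
          using d_le e1 U dpos hpos[of i] by (intro mult_mono) auto
        also have "\<dots> \<le> \<rho>" using g1(4) U by (simp add: divide_le_eq)
        finally show ?thesis by simp
      qed
      define \<eta> where "\<eta> = A2 * h i * ?H"
      have vert: "norm (\<Psi> ?t1 ?t0 v - \<Phi> (uInt i) ?t1 (- \<delta> i) v) \<le> \<eta>" if v: "v \<in> set c" for v
      proof -
        obtain y where y: "pathline (uInt i) D {?t0..?t1} y" "y ?t1 = v"
          "norm (\<Phi> (uInt i) ?t1 (- \<delta> i) v - y ?t0) \<le> K2 * \<delta> i ^ (q + 1)"
          using g3[OF v] by blast
        have "y ?t1 \<in> \<Omega>" using y v set_subset_polygon c_sub by blast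
        then have "norm (\<Psi> ?t1 ?t0 v - y ?t0) \<le> 2 * \<delta> i * e"
          using flow_vertex_error[OF y(1) _ e small\<rho>] y(2) by simp
        also have "\<dots> \<le> 2 * (h i / U) * e" using d_le e1 by (intro mult_right_mono) auto
        also have "\<dots> = (2 * E1 / U) * h i * (h i)\<^sup>2" by (simp add: e_def)
        finally have 1: "norm (\<Psi> ?t1 ?t0 v - y ?t0) \<le> (2 * E1 / U) * h i * (h i)\<^sup>2" .
        have "norm (\<Phi> (uInt i) ?t1 (- \<delta> i) v - y ?t0) \<le> \<bar>K2\<bar> * \<delta> i ^ (q + 1)"
          using dpos by (intro order_trans[OF y(3)] mult_right_mono) auto
        also have "\<dots> \<le> \<bar>K2\<bar> * (h i / U) ^ (q + 1)"
          using d_le dpos by (intro mult_left_mono power_mono) auto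
        also have "\<dots> = E2 * h i * h i ^ q" by (simp add: E2_def power_divide)
        finally have 2: "norm (\<Phi> (uInt i) ?t1 (- \<delta> i) v - y ?t0) \<le> E2 * h i * h i ^ q" .
        have "norm (\<Psi> ?t1 ?t0 v - \<Phi> (uInt i) ?t1 (- \<delta> i) v)
            \<le> (2 * E1 / U) * h i * (h i)\<^sup>2 + E2 * h i * h i ^ q"
          using norm_triangle_ineq4[of "\<Psi> ?t1 ?t0 v - y ?t0"
              "\<Phi> (uInt i) ?t1 (- \<delta> i) v - y ?t0"] 1 2 by simp
        also have "\<dots> \<le> A2 * h i * (h i)\<^sup>2 + A2 * h i * h i ^ q"
          using nn U hpos[of i] by (intro add_mono mult_right_mono) (auto simp: A2_def)
        finally show ?thesis by (simp add: \<eta>_def algebra_simps)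
      qed
      have Hpos: "?H > 0" using hpos[of i] by (simp add: add_pos_pos)
      then have \<eta>0: "\<eta> > 0" using nn hpos[of i] by (auto simp: \<eta>_def intro!: mult_pos_pos)
      have "(h i)\<^sup>2 \<le> 1" "h i ^ q \<le> 1" using hpos[of i] g1 by (auto intro!: power_le_one)
      then have "A2 * h i * ?H \<le> A2 * h i * 2" using nn hpos[of i] by (intro mult_left_mono) auto
      then have \<eta>1: "\<eta> \<le> 2 * A2 * h i" by (simp add: \<eta>_def)
      have "int_error \<Psi> \<Phi> (uInt i) (tn i) (\<delta> i) c \<le> 32 * (real N + 2) * (1 + 2 * A2) * h i * \<eta>"
        unfolding int_error_def approx_preimage_def rep_preimage_def
        by (rule cell_integration_error[OF c_simple c_sub edges[OF c] diam g1(2) hpos vert \<eta>0 \<eta>1])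
      also have "\<dots> = Cint * (h i)\<^sup>2 * ?H" by (simp add: Cint_def \<eta>_def power2_eq_square)
      finally show ?thesis .
    qed
    have vol: "M0 (polygon c \<inter> \<Psi> ?t0 ?t1 ` L i) = M0 (?P \<inter> L i)"
      using flow_preserves_liquid_volume[OF c_simple c_sub _ _ P(2) liquid] dpos by simp
    let ?Q = "liquid_neighbourhood (mesh i) (L i) c"
    have PQ: "?P \<inter> L i = ?P \<inter> ?Q" using P(1) by (auto simp: liquid_neighbourhood_def)
    have nb: "neighbourhood (mesh i) c \<in> lmeasurable" using mf(4) by (rule lmeasurable_compact)
    have meas: "approx_preimage \<Phi> (uInt i) (tn i) (\<delta> i) c \<in> lmeasurable"
      "rep_preimage \<Psi> (tn i) (\<delta> i) c \<in> lmeasurable" "?P \<in> lmeasurable" "R i c \<in> lmeasurable"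
          "?Q \<in> lmeasurable"
    proof -
      show "approx_preimage \<Phi> (uInt i) (tn i) (\<delta> i) c \<in> lmeasurable"
          "rep_preimage \<Psi> (tn i) (\<delta> i) c \<in> lmeasurable"
        by (simp_all add: approx_preimage_def rep_preimage_def lmeasurable_compact compact_polygon)
      show "?P \<in> lmeasurable"
        using dpos by (intro lmeasurable_compact compact_continuous_image compact_polygon
          continuous_on_subset[OF flow_continuous_on c_sub]) auto
      have "neighbourhood (mesh i) c \<inter> R i c \<in> lmeasurable"
        by (rule fmeasurable_Int_fmeasurable[OF nb reconstruction(2)[OF c]])
      then show "R i c \<in> lmeasurable" using reconstruction(1)[OF c] by (simp add: Int_absorb1)
      show "?Q \<in> lmeasurable" unfolding liquid_neighbourhood_def
        using fmeasurable_Int_fmeasurable[OF nb liquid(2)] by (simp add: Int_commute)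
    qed
    have "\<bar>M0 (approx_preimage \<Phi> (uInt i) (tn i) (\<delta> i) c \<inter> R i c) - M0 (?P \<inter> ?Q)\<bar>
        \<le> rec_error (mesh i) (L i) (R i) c + rep_error \<Psi> (tn i) (\<delta> i) c + int_error \<Psi> \<Phi> (uInt i)
            (tn i) (\<delta> i) c"
      unfolding rec_error_def rep_error_def int_error_def preimage_def
          by (rule measure_Int_diff_le[OF meas])
    then have "\<bar>approx_fraction \<Phi> (uInt i) (tn i) (\<delta> i) (R i) c
        - exact_fraction \<Psi> (tn i) (\<delta> i) (L i) c\<bar>
        \<le> (rec_error (mesh i) (L i) (R i) c + rep_error \<Psi> (tn i) (\<delta> i) c
          + int_error \<Psi> \<Phi> (uInt i) (tn i) (\<delta> i) c) / M0 (polygon c)"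
      unfolding approx_fraction_def exact_fraction_def vol PQ
      using Mpos(3)[OF c] by (simp add: divide_right_mono flip: diff_divide_distrib)
    with rep int show ?thesis by blast
  qed
  have nonneg: "rec_error (mesh i) (L i) (R i) c \<ge> 0" "rep_error \<Psi> (tn i) (\<delta> i) c \<ge> 0"
    "int_error \<Psi> \<Phi> (uInt i) (tn i) (\<delta> i) c \<ge> 0" for i c
    by (auto simp: rec_error_def rep_error_def int_error_def)
  have quot: "linf_norm (mesh i) (\<lambda>c. f c / M0 (polygon c)) \<le> b / (C0 * (h i)\<^sup>2)"
    if "\<And>c. c \<in> mesh i \<Longrightarrow> 0 \<le> f c \<and> f c \<le> b" for f b i
  proof (rule linf_norm_le[OF fin])
    fix c assume c: "c \<in> mesh i"
    have "f c / M0 (polygon c) \<le> b / (C0 * (h i)\<^sup>2)"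
      using that[OF c] Mpos[OF c] by (intro frac_le) auto
    then show "\<bar>f c / M0 (polygon c)\<bar> \<le> b / (C0 * (h i)\<^sup>2)" using that[OF c] by simp
  qed
  have err0: "errRec i \<ge> 0" "errRep i \<ge> 0" "errInt i \<ge> 0" "err i \<ge> 0" for i
    unfolding errRec_def errRep_def errInt_def err_def by (rule linf_norm_nonneg[OF fin])+
  have split: "\<forall>\<^sub>F i in F. err i \<le> errRec i + errRep i + errInt i"
    using good
  proof eventually_elim
    case (elim i)
    show ?case unfolding err_def
    proof (rule linf_norm_le[OF fin])
      fix c assume c: "c \<in> mesh i"
      have ge: "f c / M0 (polygon c) \<le> linf_norm (mesh i) (\<lambda>c. f c / M0 (polygon c))" for f
        using linf_norm_ge[OF fin(1) c, of "\<lambda>c. f c / M0 (polygon c)"] by linarith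
      have "\<bar>approx_fraction \<Phi> (uInt i) (tn i) (\<delta> i) (R i) c
          - exact_fraction \<Psi> (tn i) (\<delta> i) (L i) c\<bar>
        \<le> rec_error (mesh i) (L i) (R i) c / M0 (polygon c) + rep_error \<Psi> (tn i) (\<delta> i) c / M0
            (polygon c)
          + int_error \<Psi> \<Phi> (uInt i) (tn i) (\<delta> i) c / M0 (polygon c)"
        using cell[OF elim c] by (simp add: add_divide_distrib)
      also have "\<dots> \<le> errRec i + errRep i + errInt i"
        unfolding errRec_def errRep_def errInt_def by (intro add_mono ge)
      finally show "\<bar>approx_fraction \<Phi> (uInt i) (tn i) (\<delta> i) (R i) c
          - exact_fraction \<Psi> (tn i) (\<delta> i) (L i) c\<bar>
        \<le> errRec i + errRep i + errInt i" .
    qed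
  qed
  have Rec: "errRec \<in> O[F](\<lambda>i. h i powr (r - 2))"
  proof -
    obtain K where K: "\<forall>\<^sub>F i in F. norm (linf_norm (mesh i) (rec_error (mesh i) (L i) (R i)))
        \<le> K * norm (h i powr r)"
      using reconstruction_order by (auto elim!: landau_o.bigE)
    show ?thesis
    proof (rule bigoI[of _ "K / C0"])
      show "\<forall>\<^sub>F i in F. norm (errRec i) \<le> K / C0 * norm (h i powr (r - 2))"
        using K
      proof eventually_elim
        case (elim i)
        have "errRec i \<le> (K * h i powr r) / (C0 * (h i)\<^sup>2)"
          unfolding errRec_def
        proof (rule quot)
          fix c assume c: "c \<in> mesh i"
          show "0 \<le> rec_error (mesh i) (L i) (R i) c \<and> rec_error (mesh i) (L i) (R i) c
              \<le> K * h i powr r"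
            using nonneg(1)[of i c] linf_norm_ge[OF fin(1) c, of
                "rec_error (mesh i) (L i) (R i)"] elim by simp
        qed
        also have "\<dots> = K / C0 * h i powr (r - 2)"
          using hpos[of i] by (simp add: powr_diff)
        finally show ?case using err0(1)[of i] by simp
      qed
    qed
  qed
  have Rep: "errRep \<in> O[F](\<lambda>i. (h i)\<^sup>2)"
  proof (rule bigoI[of _ "Crep / C0"])
    show "\<forall>\<^sub>F i in F. norm (errRep i) \<le> Crep / C0 * norm ((h i)\<^sup>2)"
      using good
    proof eventually_elim
      case (elim i)
      have "errRep i \<le> (Crep * h i ^ 4) / (C0 * (h i)\<^sup>2)"
        unfolding errRep_def by (rule quot) (use cell[OF elim] nonneg in blast)
      also have "\<dots> = Crep / C0 * (h i)\<^sup>2" using hpos[of i] quasi_uniform(1)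
          by (simp add: field_simps power_numeral_reduce)
      finally show ?case using err0(2)[of i] by simp
    qed
  qed
  have Int: "errInt \<in> O[F](\<lambda>i. (h i)\<^sup>2 + h i ^ q)"
  proof (rule bigoI[of _ "Cint / C0"])
    show "\<forall>\<^sub>F i in F. norm (errInt i) \<le> Cint / C0 * norm ((h i)\<^sup>2 + h i ^ q)"
      using good
    proof eventually_elim
      case (elim i)
      let ?H = "(h i)\<^sup>2 + h i ^ q"
      have "errInt i \<le> (Cint * (h i)\<^sup>2 * ?H) / (C0 * (h i)\<^sup>2)"
        unfolding errInt_def by (rule quot) (use cell[OF elim] nonneg in blast)
      also have "\<dots> = Cint / C0 * ?H" using hpos[of i] by simp
      also have "?H = norm ?H" using hpos[of i] by simp
      finally show ?case using err0(3)[of i] by simp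
    qed
  qed
  have "err \<in> O[F](\<lambda>i. h i powr (r - 2)) + O[F](\<lambda>i. (h i)\<^sup>2) + O[F](\<lambda>i. (h i)\<^sup>2 + h i ^ q)"
    by (rule bigo_sum_decomposition[where ?f1.0 = errRec and ?f2.0 = errRep and ?f3.0 = errInt])
      (use split err0 Rec Rep Int in simp_all)
  with split Rec Rep Int show ?thesis by blast
qed

end
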